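(* (i) Let $m,a$ be positive integers and $d=\gcd(a,m)$. Then $$\sum_{N\ge0}|{}^0_a\Sigma_{m,N}|\,x^{N/a}=\frac{\prod_{k\ge1}(1-x^{\frac md k})^d}{\prod_{k\ge1}(1-x^k)^m}.$$ (ii) Let $l$ be an integer, $m_0=2l+1$ ($l\ge0$) for type A and $m=2l$ ($l\ge1$) for types C and D. Then $$\sum_{n\ge0}|{}^0\Sigma^A_{m_0,2n}|x^n=\prod_{k\ge1}\frac{1-x^{(2l+1)k}}{(1-x^k)^{l+1}},\qquad \sum_{n\ge0}|{}^0\Sigma^C_{m,2n}|x^n=\prod_{k\ge1}\frac{(1-x^{2lk})(1+x^k)}{(1-x^k)^l},$$ $$\sum_{n\ge0}|{}^0\Sigma^D_{m,2n}|x^n=\prod_{k\ge1}\frac{1-x^{2lk}}{(1-x^k)^{l+1}(1+x^k)}.$$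
   Context: Fix a sign $\pm$. For a positive integer $k$, a Young $(k,+)$-diagram (resp. $(k,-)$-diagram) is a Young diagram whose rows are filled with consecutive decreasing (resp. increasing) numbers from $\{1,\dots,k\}$, read cyclically ($k$ identified with $0$); diagrams are identified if they differ by interchanging rows. Write $$\lambda=(\lambda_1)_1^{p_1^1}\cdots(\lambda_1)_k^{p_1^k}\cdots(\lambda_s)_1^{p_s^1}\cdots(\lambda_s)_k^{p_s^k},\quad \lambda_1>\cdots>\lambda_s>0,\ \textstyle\sum_jp_i^j>0,$$ for the diagram with $p_i^j$ rows of length $\lambda_i$ whose beginning box is filled with $j$. Its number of boxes is $|\lambda|=\sum_i\sum_jp_i^j\lambda_i$. ${}^0_a\Sigma_{m,N}$: the set of Young $(m,\pm)$-diagrams with $N$ boxes such that $a$ divides $\gcd(\lambda_1,\dots,\lambda_s)$ and $\prod_{k=0}^{m/d-1}p_j^{i+kd}=0$ for each $j\in[1,s]$ and each $i\in[1,d]$, where $d=\gcd(a,m)$. (So it is empty unless $a\mid N$; the empty diagram is counted for $N=0$.) $\Sigma^A_{m_0,2n}$: the set of Young $(m_0,\pm)$-diagrams with $2n$ boxes such that for every $i$: $p_i^a=p_i^b$ if $a+b\equiv\lambda_i \pmod{m_0}$, and $p_i^a$ is even if $2a\equiv\lambda_i\pmod{m_0}$. $\Sigma^C_{m,2n}$: the set of Young $(m,\pm)$-diagrams with $2n$ boxes such that for every $i$: $p_i^a=p_i^b$ if $a+b\equiv\lambda_i-1\pmod m$, and $p_i^a$ is even if $2a\equiv\lambda_i-1\pmod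 m$. $\Sigma^D_{m,2n}$: the set of Young $(m,\pm)$-diagrams with $2n$ boxes such that for every $i$: $p_i^a=p_i^b$ if $a+b\equiv\lambda_i\pmod m$, and $p_i^a$ is even if $2a\equiv\lambda_i\pmod m$. ${}^0\Sigma^A_{m_0,2n}\subset\Sigma^A_{m_0,2n}$ (resp. ${}^0\Sigma^C_{m,2n}\subset\Sigma^C_{m,2n}$, ${}^0\Sigma^D_{m,2n}\subset\Sigma^D_{m,2n}$) is the subset of diagrams such that for each $i\in[1,s]$ one has $\min\{p_i^j: j\in[1,m_0]\}\le1$ (resp. $\min\{p_i^j:j\in[1,m]\}\le1$). The empty diagram is included for $n=0$. *)

theory Defs
  imports
    "HOL-Analysis.Analysis"
    "HOL-Computational_Algebra.Formal_Power_Series"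
    "HOL-Library.Multiset"
    "HOL-Number_Theory.Cong"
begin

datatype sign = Plus | Minus

text \<open>
  A row is the list of the entries of its boxes, from the beginning box on.  Entries are consecutive
  modulo \<open>k\<close>: decreasing for the sign \<open>+\<close>, increasing for the sign \<open>-\<close>.
\<close>
definition filled_row :: "sign \<Rightarrow> nat \<Rightarrow> nat list \<Rightarrow> bool" where
  "filled_row \<epsilon> k r \<longleftrightarrow> r \<noteq> [] \<and> set r \<subseteq> {1..k} \<and>
     (\<forall>i. Suc i < length r \<longrightarrow>
        (case \<epsilon> of
           Plus \<Rightarrow> [r ! i = r ! Suc i + 1] (mod k)
         | Minus \<Rightarrow> [r ! Suc i = r ! i + 1] (mod k)))"

text \<open>
  As diagrams are identified when they differ by interchanging rows, a diagram is the multiset of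
  its rows.
\<close>
definition young_diagrams :: "sign \<Rightarrow> nat \<Rightarrow> nat list multiset set" where
  "young_diagrams \<epsilon> k = {Y. \<forall>r\<in>#Y. filled_row \<epsilon> k r}"

definition boxes :: "nat list multiset \<Rightarrow> nat" where
  "boxes Y = (\<Sum>r\<in>#Y. length r)"

definition diagrams :: "sign \<Rightarrow> nat \<Rightarrow> nat \<Rightarrow> nat list multiset set" where
  "diagrams \<epsilon> k N = {Y \<in> young_diagrams \<epsilon> k. boxes Y = N}"

text \<open>The set \<open>{\<lambda>\<^sub>1, \<dots>, \<lambda>\<^sub>s}\<close> of row lengths.\<close>
definition row_lengths :: "nat list multiset \<Rightarrow> nat set" where
  "row_lengths Y = length ` set_mset Y"

text \<open>
  For \<open>len = \<lambda>\<^sub>i\<close> this is the exponent with lower index \<open>i\<close> and upper index \<open>j\<close>: the number of rows of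
  length \<open>len\<close> whose beginning box is filled with \<open>j\<close>.  Rows are indexed by their length instead of
  by \<open>i\<close>, so conditions for all \<open>i\<close> become conditions for all elements of \<^const>\<open>row_lengths\<close>.
\<close>
definition mult :: "nat list multiset \<Rightarrow> nat \<Rightarrow> nat \<Rightarrow> nat" where
  "mult Y len j = size {#r \<in># Y. length r = len \<and> hd r = j#}"

definition Sigma0 :: "sign \<Rightarrow> nat \<Rightarrow> nat \<Rightarrow> nat \<Rightarrow> nat list multiset set" where
  "Sigma0 \<epsilon> a m N = {Y \<in> diagrams \<epsilon> m N.
     a dvd Gcd (row_lengths Y) \<and>
     (let d = gcd a m in
      \<forall>len\<in>row_lengths Y. \<forall>i\<in>{1..d}. (\<Prod>k = 0..m div d - 1. mult Y len (i + k * d)) = 0)}"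

definition Sigma_A :: "sign \<Rightarrow> nat \<Rightarrow> nat \<Rightarrow> nat list multiset set" where
  "Sigma_A \<epsilon> m N = {Y \<in> diagrams \<epsilon> m N. \<forall>len\<in>row_lengths Y.
     (\<forall>a\<in>{1..m}. \<forall>b\<in>{1..m}. [a + b = len] (mod m) \<longrightarrow> mult Y len a = mult Y len b) \<and>
     (\<forall>a\<in>{1..m}. [2 * a = len] (mod m) \<longrightarrow> even (mult Y len a))}"

text \<open>Row lengths are positive, so the subtraction does not truncate.\<close>
definition Sigma_C :: "sign \<Rightarrow> nat \<Rightarrow> nat \<Rightarrow> nat list multiset set" where
  "Sigma_C \<epsilon> m N = {Y \<in> diagrams \<epsilon> m N. \<forall>len\<in>row_lengths Y.
     (\<forall>a\<in>{1..m}. \<forall>b\<in>{1..m}. [a + b = len - 1] (mod m) \<longrightarrow> mult Y len a = mult Y len b) \<and>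
     (\<forall>a\<in>{1..m}. [2 * a = len - 1] (mod m) \<longrightarrow> even (mult Y len a))}"

definition Sigma_D :: "sign \<Rightarrow> nat \<Rightarrow> nat \<Rightarrow> nat list multiset set" where
  "Sigma_D \<epsilon> m N = {Y \<in> diagrams \<epsilon> m N. \<forall>len\<in>row_lengths Y.
     (\<forall>a\<in>{1..m}. \<forall>b\<in>{1..m}. [a + b = len] (mod m) \<longrightarrow> mult Y len a = mult Y len b) \<and>
     (\<forall>a\<in>{1..m}. [2 * a = len] (mod m) \<longrightarrow> even (mult Y len a))}"

definition min_le_one :: "nat \<Rightarrow> nat list multiset \<Rightarrow> bool" where
  "min_le_one m Y \<longleftrightarrow> (\<forall>len\<in>row_lengths Y. Min (mult Y len ` {1..m}) \<le> 1)"

definition Sigma0_A :: "sign \<Rightarrow> nat \<Rightarrow> nat \<Rightarrow> nat list multiset set" where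
  "Sigma0_A \<epsilon> m N = {Y \<in> Sigma_A \<epsilon> m N. min_le_one m Y}"

definition Sigma0_C :: "sign \<Rightarrow> nat \<Rightarrow> nat \<Rightarrow> nat list multiset set" where
  "Sigma0_C \<epsilon> m N = {Y \<in> Sigma_C \<epsilon> m N. min_le_one m Y}"

definition Sigma0_D :: "sign \<Rightarrow> nat \<Rightarrow> nat \<Rightarrow> nat list multiset set" where
  "Sigma0_D \<epsilon> m N = {Y \<in> Sigma_D \<epsilon> m N. min_le_one m Y}"

text \<open>Hence \<^const>\<open>card\<close> is the true cardinality of each of the sets above.\<close>
lemma finite_diagrams: "finite (diagrams \<epsilon> k N)"
proof -
  let ?R = "{r. set r \<subseteq> {1..k} \<and> length r \<le> N}"
  have R: "finite ?R"
    by (rule finite_lists_length_le) simp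
  have "diagrams \<epsilon> k N \<subseteq> (\<Union>n\<in>{..N}. multisets_of_size ?R n)"
  proof
    fix Y assume Y: "Y \<in> diagrams \<epsilon> k N"
    then have rows: "filled_row \<epsilon> k r" if "r \<in># Y" for r
      using that by (auto simp: diagrams_def young_diagrams_def)
    have N: "(\<Sum>r\<in>#Y. length r) = N"
      using Y by (simp add: diagrams_def boxes_def)
    have len: "length r \<le> N" if "r \<in># Y" for r
      using that N by (metis le_add1 image_mset_add_mset insert_DiffM sum_mset.add_mset)
    have "size Y = (\<Sum>r\<in>#Y. 1)"
      by simp
    also have "\<dots> \<le> (\<Sum>r\<in>#Y. length r)"
      using rows by (intro sum_mset_mono) (auto simp: filled_row_def Suc_le_eq)
    finally have "size Y \<le> N"
      using N by simp
    with rows len show "Y \<in> (\<Union>n\<in>{..N}. multisets_of_size ?R n)"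
      by (auto simp: multisets_of_size_def filled_row_def)
  qed
  moreover have "finite (\<Union>n\<in>{..N}. multisets_of_size ?R n)"
    using R by (auto intro: finite_multisets_of_size)
  ultimately show ?thesis
    by (rule finite_subset)
qed

end

theory Submission
  imports Defs
begin

unbundle no vec_syntax
unbundle fps_syntax

text \<open>
  A row is determined by its length and its beginning entry, so a diagram is a family of tuples
  \<open>(p\<^sub>1, \<dots>, p\<^sub>m)\<close>, one for each possible row length, and the conditions constrain each length
  separately.  Hence the generating function is an infinite product, and the factor of a row length
  counts tuples that are small at some index: all tuples minus those dominating a fixed tuple \<open>b\<close>.
  For \<open>n\<close>-tuples this is \<open>(1 - y\<^bsup>\<Sum>b\<^esup>) / (1 - y)\<^bsup>n\<^esup>\<close>, where \<open>y\<close> is the weight of one row (of one orbit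
  of rows in (ii)).  In (i) the tuple splits into \<open>d\<close> such blocks, with \<open>b = 1\<close>.  In (ii) it is
  symmetric under the reflection \<open>a \<mapsto> c - a\<close> of the residues, so only one
  representative of each orbit is free; \<open>b\<close> is \<open>1\<close> at the fixed points, where half of the even entry is
  counted, and \<open>2\<close> elsewhere.  For even \<open>m\<close> the number of fixed points depends on the parity of the row
  length, and the factors of the odd row lengths are recombined by Euler's theorem on partitions into
  odd and into distinct parts.
\<close>

subsection \<open>Counting series\<close>

definition gf :: "'a set \<Rightarrow> ('a \<Rightarrow> nat) \<Rightarrow> rat fps" where
  "gf A w = Abs_fps (\<lambda>n. of_nat (card {x \<in> A. w x = n}))"

text \<open>Since \<open>card\<close> is 0 on infinite sets, the coefficients of \<open>gf\<close>
  are genuine counts only under this condition; it is carried along with every series.\<close>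

definition finite_fibres :: "'a set \<Rightarrow> ('a \<Rightarrow> nat) \<Rightarrow> bool" where
  "finite_fibres A w \<longleftrightarrow> (\<forall>n. finite {x \<in> A. w x = n})"

lemma finite_fibres_mono: "finite_fibres B w \<Longrightarrow> A \<subseteq> B \<Longrightarrow> finite_fibres A w"
  unfolding finite_fibres_def by (auto intro: rev_finite_subset)

lemma bij_betw_fibres:
  assumes "bij_betw h A B" "\<And>x. x \<in> A \<Longrightarrow> v (h x) = w x"
  shows "bij_betw h {x \<in> A. w x = n} {y \<in> B. v y = n}"
proof (rule bij_betw_imageI)
  show "inj_on h {x \<in> A. w x = n}"
    using assms(1) by (auto simp: bij_betw_def intro: inj_on_subset)
  have B: "B = h ` A"
    using assms(1) by (simp add: bij_betw_def)
  show "h ` {x \<in> A. w x = n} = {y \<in> B. v y = n}"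
    unfolding B using assms(2) by auto
qed

lemma gf_bij_betw:
  assumes "bij_betw h A B" "\<And>x. x \<in> A \<Longrightarrow> v (h x) = w x"
  shows "gf A w = gf B v"
  unfolding gf_def using bij_betw_same_card[OF bij_betw_fibres[of h A B v w, OF assms]] by presburger

lemma finite_fibres_bij_betw:
  assumes "bij_betw h A B" "\<And>x. x \<in> A \<Longrightarrow> v (h x) = w x"
  shows "finite_fibres A w \<longleftrightarrow> finite_fibres B v"
  unfolding finite_fibres_def using bij_betw_finite[OF bij_betw_fibres[of h A B v w, OF assms]] by presburger

text \<open>Sorting pairs by the weight of the first component gives finitely many disjoint
  rectangles; their sizes are the terms of the Cauchy product.\<close>

lemma fibre_Times:
  fixes n :: nat
  shows "{x \<in> A \<times> B. (case x of (a, b) \<Rightarrow> w a + v b) = n} =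
     (\<Union>i\<in>{0..n}. {a \<in> A. w a = i} \<times> {b \<in> B. v b = n - i})"
  by auto

lemma finite_fibres_Times:
  assumes "finite_fibres A w" "finite_fibres B v"
  shows "finite_fibres (A \<times> B) (\<lambda>(a, b). w a + v b)"
  using assms unfolding finite_fibres_def fibre_Times by blast

lemma gf_Times:
  assumes "finite_fibres A w" "finite_fibres B v"
  shows "gf (A \<times> B) (\<lambda>(a, b). w a + v b) = gf A w * gf B v"
proof (rule fps_ext)
  fix n
  have "card {x \<in> A \<times> B. (case x of (a, b) \<Rightarrow> w a + v b) = n} =
      (\<Sum>i\<in>{0..n}. card ({a \<in> A. w a = i} \<times> {b \<in> B. v b = n - i}))"
    unfolding fibre_Times
    by (rule card_UN_disjoint) (use assms in \<open>auto simp: finite_fibres_def\<close>)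
  then show "gf (A \<times> B) (\<lambda>(a, b). w a + v b) $ n = (gf A w * gf B v) $ n"
    by (simp add: gf_def fps_mult_nth card_cartesian_product)
qed

lemma bij_betw_PiE_insert:
  assumes "i \<notin> I"
  shows "bij_betw (\<lambda>(y, g). g(i := y)) (A i \<times> Pi\<^sub>E I A) (Pi\<^sub>E (insert i I) A)"
  using assms by (simp add: bij_betw_def PiE_insert_eq inj_combinator)

text \<open>Both claims go through one induction, because the product rule for the next factor
  requires finite fibres of the factors already collected.\<close>

lemma gf_PiE:
  assumes "finite I" "\<And>i. i \<in> I \<Longrightarrow> finite_fibres (A i) (w i)"
  shows "gf (Pi\<^sub>E I A) (\<lambda>f. \<Sum>i\<in>I. w i (f i)) = (\<Prod>i\<in>I. gf (A i) (w i))"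
    and "finite_fibres (Pi\<^sub>E I A) (\<lambda>f. \<Sum>i\<in>I. w i (f i))"
proof -
  have "gf (Pi\<^sub>E I A) (\<lambda>f. \<Sum>i\<in>I. w i (f i)) = (\<Prod>i\<in>I. gf (A i) (w i)) \<and>
    finite_fibres (Pi\<^sub>E I A) (\<lambda>f. \<Sum>i\<in>I. w i (f i))"
    using assms
  proof (induction I rule: finite_induct)
    case empty
    \<comment> \<open>The extensional function space over the empty set has the single element
      \<open>\<lambda>_. undefined\<close>, of weight 0, so its series is 1.\<close>
    have "{x. x = (\<lambda>_. undefined) \<and> 0 = n} = (if n = 0 then {\<lambda>_. undefined} else {})" for n :: nat
      by auto
    then show ?case
      by (auto simp: gf_def finite_fibres_def fps_eq_iff)
  next
    case (insert i I)
    let ?w = "\<lambda>f. \<Sum>i\<in>I. w i (f i)" and ?h = "\<lambda>(y, g). g(i := y)"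
    let ?w' = "\<lambda>f. \<Sum>j\<in>insert i I. w j (f j)"
    have ff: "finite_fibres (A i) (w i)" "finite_fibres (Pi\<^sub>E I A) ?w"
      and IH: "gf (Pi\<^sub>E I A) ?w = (\<Prod>i\<in>I. gf (A i) (w i))"
      using insert by auto
    have eq: "(\<Sum>j\<in>insert i I. w j (?h x j)) = (case x of (a, g) \<Rightarrow> w i a + ?w g)" for x
      using insert.hyps by (auto split: prod.split intro!: sum.cong)
    show ?case
      using gf_bij_betw[of ?h _ _ ?w', OF bij_betw_PiE_insert[OF insert.hyps(2)] eq]
        finite_fibres_bij_betw[of ?h _ _ ?w', OF bij_betw_PiE_insert[OF insert.hyps(2)] eq]
        gf_Times[OF ff] finite_fibres_Times[OF ff] insert.hyps IH
      by simp
  qed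
  then show "gf (Pi\<^sub>E I A) (\<lambda>f. \<Sum>i\<in>I. w i (f i)) = (\<Prod>i\<in>I. gf (A i) (w i))"
    and "finite_fibres (Pi\<^sub>E I A) (\<lambda>f. \<Sum>i\<in>I. w i (f i))" by auto
qed

lemma gf_Diff:
  assumes "finite_fibres A w" "B \<subseteq> A"
  shows "gf (A - B) w = gf A w - gf B w"
proof (rule fps_ext)
  fix n
  have "{x \<in> A - B. w x = n} = {x \<in> A. w x = n} - {x \<in> B. w x = n}"
    by auto
  moreover have "finite {x \<in> B. w x = n}"
    using finite_fibres_mono[OF assms] by (simp add: finite_fibres_def)
  moreover have "card {x \<in> B. w x = n} \<le> card {x \<in> A. w x = n}"
    using assms by (intro card_mono) (auto simp: finite_fibres_def)
  ultimately show "gf (A - B) w $ n = (gf A w - gf B w) $ n"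
    using assms(2) by (simp add: gf_def) (subst card_Diff_subset; auto simp: of_nat_diff)
qed

section \<open>Geometric series and tuples that fail to dominate a fixed tuple\<close>

lemma fibre_atLeast:
  fixes b c n :: nat
  assumes "c > 0"
  shows "{x \<in> {b..}. c * x = n} = (if c dvd n \<and> c * b \<le> n then {n div c} else {})"
  using assms by (auto simp: less_eq_div_iff_mult_less_eq mult.commute)

lemma finite_fibres_atLeast: "c > 0 \<Longrightarrow> finite_fibres {b..} (\<lambda>x. c * x)"
  unfolding finite_fibres_def by (simp only: fibre_atLeast) simp

text \<open>Multiplication by \<open>1 - fps_X ^ c\<close> subtracts the progression
  \<open>c * b, c * (b + 1), ...\<close> shifted by \<open>c\<close> from itself, and only its first
  term survives.\<close>

lemma gf_atLeast:
  assumes "c > 0"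
  shows "gf {b..} (\<lambda>x. c * x) = fps_X ^ (c * b) / (1 - fps_X ^ c)"
proof -
  have "gf {b..} (\<lambda>x. c * x) * (1 - fps_X ^ c) = fps_X ^ (c * b)"
  proof (rule fps_ext)
    fix n
    let ?S = "\<lambda>n. {x \<in> {b..}. c * x = n}"
    have nth: "(gf {b..} (\<lambda>x. c * x) * (1 - fps_X ^ c)) $ n =
        of_nat (card (?S n)) - (if n < c then 0 else of_nat (card (?S (n - c))))"
      by (simp add: gf_def right_diff_distrib fps_X_power_mult_right_nth)
    have mult: "?S (c * k) = (if b \<le> k then {k} else {})" for k
      unfolding fibre_atLeast[OF assms] using assms by simp
    \<comment> \<open>At 0 no shifted term arrives; at a positive multiple of \<open>c\<close> the
      fibres at \<open>n\<close> and \<open>n - c\<close> are compared; elsewhere both are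
      empty.\<close>
    consider "n = 0" | k where "n = c * Suc k" | "\<not> c dvd n"
      by (metis dvdE mult_0_right not0_implies_Suc)
    then show "(gf {b..} (\<lambda>x. c * x) * (1 - fps_X ^ c)) $ n = (fps_X ^ (c * b) :: rat fps) $ n"
    proof cases
      case 1
      then show ?thesis
        unfolding nth using mult[of 0] assms by (simp add: fps_X_power_nth)
    next
      case (2 k)
      then have "n - c = c * k" "n \<ge> c"
        by simp_all
      moreover have "c * Suc k = c * b \<longleftrightarrow> b = Suc k"
        using assms by (metis mult_cancel1 not_gr_zero)
      ultimately show ?thesis
        unfolding nth fps_X_power_nth \<open>n - c = c * k\<close> mult unfolding 2 mult by simp
    next
      case 3
      then have "\<not> c dvd n - c" if "n \<ge> c"
        using that by (simp add: dvd_minus_self)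
      then have "?S (n - c) = {}" if "n \<ge> c"
        unfolding fibre_atLeast[OF assms] using that by simp
      moreover have "?S n = {}" "n \<noteq> c * b"
        using 3 by auto
      ultimately show ?thesis
        unfolding nth fps_X_power_nth by (cases "n < c") (simp_all del: Collect_empty_eq)
    qed
  qed
  moreover have "(1 - fps_X ^ c :: rat fps) $ 0 \<noteq> 0"
    using assms by simp
  ultimately show ?thesis
    by (metis fps_divide_times_eq fps_nonzero_nth mult.commute nonzero_mult_div_cancel_right)
qed

text \<open>The complement consists of the tuples dominating \<open>b\<close>, a product of rays,
  and so is the set of all tuples. Both series are products of geometric series with the same
  denominator.\<close>

lemma gf_exists_less:
  fixes b :: "'i \<Rightarrow> nat"
  assumes "finite I" "c > 0"
  shows "gf {q \<in> Pi\<^sub>E I (\<lambda>_. UNIV). \<exists>i\<in>I. q i < b i} (\<lambda>q. c * (\<Sum>i\<in>I. q i)) =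
      (1 - fps_X ^ (c * (\<Sum>i\<in>I. b i))) / (1 - fps_X ^ c) ^ card I"
    and "finite_fibres {q \<in> Pi\<^sub>E I (\<lambda>_. UNIV). \<exists>i\<in>I. q i < b i} (\<lambda>q. c * (\<Sum>i\<in>I. q i))"
proof -
  let ?w = "\<lambda>q. c * (\<Sum>i\<in>I. q i)"
  have "(1 - fps_X ^ c :: rat fps) $ 0 \<noteq> 0"
    using assms by simp
  then have pow0: "((1 - fps_X ^ c) ^ card I :: rat fps) $ 0 \<noteq> 0"
    using assms by (simp add: fps_power_zeroth)
  \<comment> \<open>This \<open>b\<close> is a fresh variable: the given tuple yields the dominating
    tuples, the zero tuple yields all of them.\<close>
  have gf: "gf (Pi\<^sub>E I (\<lambda>i. {b i..})) ?w = fps_X ^ (c * (\<Sum>i\<in>I. b i)) / (1 - fps_X ^ c) ^ card I" for b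
    using gf_PiE(1)[of I "\<lambda>i. {b i..}" "\<lambda>_ x. c * x", OF assms(1) finite_fibres_atLeast[OF assms(2)]] assms
    by (simp add: gf_atLeast sum_distrib_left power_sum fps_divide_unit prod.distrib fps_inverse_power)
  have eq: "{q \<in> Pi\<^sub>E I (\<lambda>_. UNIV). \<exists>i\<in>I. q i < b i} = Pi\<^sub>E I (\<lambda>_. {0..}) - Pi\<^sub>E I (\<lambda>i. {b i..})"
  proof (rule set_eqI)
    fix q
    have "q \<in> Pi\<^sub>E I (\<lambda>i. {b i..}) \<longleftrightarrow> q \<in> Pi\<^sub>E I (\<lambda>_. UNIV) \<and> (\<forall>i\<in>I. b i \<le> q i)"
      "q \<in> Pi\<^sub>E I (\<lambda>_. {0..}) \<longleftrightarrow> q \<in> Pi\<^sub>E I (\<lambda>_. UNIV)"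
      by (auto simp: PiE_iff)
    then show "q \<in> {q \<in> Pi\<^sub>E I (\<lambda>_. UNIV). \<exists>i\<in>I. q i < b i} \<longleftrightarrow>
        q \<in> Pi\<^sub>E I (\<lambda>_. {0..}) - Pi\<^sub>E I (\<lambda>i. {b i..})"
      by (simp add: not_le) blast
  qed
  have ff: "finite_fibres (Pi\<^sub>E I (\<lambda>_. {0..})) ?w"
    using gf_PiE(2)[of I "\<lambda>i. {0..}" "\<lambda>_ x. c * x", OF assms(1) finite_fibres_atLeast[OF assms(2)]]
    by (simp add: sum_distrib_left)
  show "gf {q \<in> Pi\<^sub>E I (\<lambda>_. UNIV). \<exists>i\<in>I. q i < b i} ?w =
      (1 - fps_X ^ (c * (\<Sum>i\<in>I. b i))) / (1 - fps_X ^ c) ^ card I"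
    unfolding eq using pow0
    by (subst gf_Diff[OF ff]) (auto simp: gf PiE_iff fps_divide_unit left_diff_distrib gf[of "\<lambda>_. 0", simplified])
  show "finite_fibres {q \<in> Pi\<^sub>E I (\<lambda>_. UNIV). \<exists>i\<in>I. q i < b i} ?w"
    unfolding eq by (rule finite_fibres_mono[OF ff]) blast
qed

subsection \<open>Infinite products of formal power series\<close>

lemma fps_mult_nth_cong:
  assumes "\<And>i. i \<le> n \<Longrightarrow> f $ i = f' $ i" "\<And>i. i \<le> n \<Longrightarrow> g $ i = g' $ i"
  shows "(f * g) $ n = (f' * g') $ n"
  using assms by (auto simp: fps_mult_nth intro!: sum.cong)

text \<open>The factor with index \<open>k\<close> stands for the mathematical factor with index
  \<open>Suc k\<close>, a series in which the first nonconstant term has degree at least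
  \<open>Suc k\<close>. This one bound gives convergence and is stable under all operations used
  below.\<close>

definition fps_near_one :: "(nat \<Rightarrow> rat fps) \<Rightarrow> bool" where
  "fps_near_one f \<longleftrightarrow> (\<forall>k. \<forall>n\<le>k. f k $ n = 1 $ n)"

named_theorems near_one

lemma fps_near_one_1 [near_one]: "fps_near_one (\<lambda>_. 1)"
  by (simp add: fps_near_one_def)

lemma fps_near_one_mult [near_one]:
  assumes "fps_near_one f" "fps_near_one g"
  shows "fps_near_one (\<lambda>k. f k * g k)"
  unfolding fps_near_one_def
proof (intro allI impI)
  fix k n :: nat assume "n \<le> k"
  then have "(f k * g k) $ n = (1 * 1) $ n"
    using assms by (intro fps_mult_nth_cong) (auto simp: fps_near_one_def)
  then show "(f k * g k) $ n = 1 $ n" by simp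
qed

lemma fps_near_one_power [near_one]: "fps_near_one f \<Longrightarrow> fps_near_one (\<lambda>k. f k ^ p)"
  by (induction p) (auto intro: near_one)

lemma fps_near_one_nz: "fps_near_one f \<Longrightarrow> f k $ 0 \<noteq> 0"
  by (simp add: fps_near_one_def)

lemma fps_near_one_divide [near_one]:
  assumes "fps_near_one f" "fps_near_one g"
  shows "fps_near_one (\<lambda>k. f k / g k)"
proof -
  have "fps_near_one (\<lambda>k. inverse (g k))"
    unfolding fps_near_one_def
  proof (intro allI impI)
    fix k n :: nat assume "n \<le> k"
    \<comment> \<open>Up to degree \<open>n\<close> the series \<open>g k\<close> may be replaced by
      1, which turns \<open>inverse (g k)\<close> into
      \<open>g k * inverse (g k) = 1\<close>.\<close>
    then have "(1 * inverse (g k)) $ n = (g k * inverse (g k)) $ n"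
      using assms by (intro fps_mult_nth_cong) (auto simp: fps_near_one_def)
    then show "inverse (g k) $ n = 1 $ n"
      using fps_near_one_nz[OF assms(2)] by (simp add: inverse_mult_eq_1')
  qed
  then show ?thesis
    using fps_near_one_nz[OF assms(2)] fps_near_one_mult[OF assms(1)] by (simp add: fps_divide_unit)
qed

lemma fps_near_one_minus_X [near_one]: "c > 0 \<Longrightarrow> fps_near_one (\<lambda>k. 1 - fps_X ^ (c * Suc k))"
  and fps_near_one_plus_X [near_one]: "c > 0 \<Longrightarrow> fps_near_one (\<lambda>k. 1 + fps_X ^ (c * Suc k))"
proof -
  have "n \<noteq> c * Suc k" if "n \<le> k" "c > 0" for n k
    using that by (cases c) auto
  then show "c > 0 \<Longrightarrow> fps_near_one (\<lambda>k. 1 - fps_X ^ (c * Suc k))"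
    and "c > 0 \<Longrightarrow> fps_near_one (\<lambda>k. 1 + fps_X ^ (c * Suc k))"
    by (auto simp: fps_near_one_def fps_X_power_nth)
qed

lemma fps_near_one_minus_X_Suc [near_one]: "fps_near_one (\<lambda>k. 1 - fps_X ^ Suc k)"
  and fps_near_one_plus_X_Suc [near_one]: "fps_near_one (\<lambda>k. 1 + fps_X ^ Suc k)"
  using fps_near_one_minus_X[of 1] fps_near_one_plus_X[of 1] by simp_all

lemma fps_near_one_if [near_one]:
  "fps_near_one f \<Longrightarrow> fps_near_one g \<Longrightarrow> fps_near_one (\<lambda>k. if P k then f k else g k)"
  by (simp add: fps_near_one_def)

text \<open>Every factor with index at least \<open>n\<close> agrees with 1 up to degree
  \<open>n\<close>, so it leaves coefficient \<open>n\<close> of the product unchanged.\<close>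

lemma prod_near_one_nth:
  assumes "fps_near_one f" "n \<le> L"
  shows "(\<Prod>k<L. f k) $ n = (\<Prod>k<n. f k) $ n"
  using assms(2)
proof (induction L rule: dec_induct)
  case (step L)
  then have "((\<Prod>k<L. f k) * f L) $ n = ((\<Prod>k<L. f k) * 1) $ n"
    using assms(1) by (intro fps_mult_nth_cong) (auto simp: fps_near_one_def)
  then show ?case using step by simp
qed simp

lemma fps_near_one_has_prod:
  assumes "fps_near_one f"
  shows "f has_prod prodinf f" "(\<lambda>L. \<Prod>k<L. f k) \<longlonglongrightarrow> prodinf f" "prodinf f \<noteq> 0"
proof -
  define p where "p = Abs_fps (\<lambda>n. (\<Prod>k<n. f k) $ n)"
  have lim: "(\<lambda>L. \<Prod>k<L. f k) \<longlonglongrightarrow> p"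
    by (intro tendsto_fpsI eventually_sequentiallyI)
      (simp only: p_def fps_nth_Abs_fps, rule prod_near_one_nth[OF assms])
  \<comment> \<open>The coefficient of degree 0 comes from the empty product. A nonzero limit is
    part of the meaning of \<open>has_prod\<close>.\<close>
  have p0: "p $ 0 \<noteq> 0" by (simp add: p_def)
  then have "p \<noteq> 0" by auto
  with lim have "f has_prod p"
    by (simp add: has_prod_def raw_has_prod_def LIMSEQ_lessThan_iff_atMost[symmetric])
  with lim \<open>p \<noteq> 0\<close> show "f has_prod prodinf f" "(\<lambda>L. \<Prod>k<L. f k) \<longlonglongrightarrow> prodinf f" "prodinf f \<noteq> 0"
    by (simp_all add: has_prod_unique[symmetric])
qed

text \<open>Convergence means that each coefficient is eventually constant, and coefficient
  \<open>n\<close> of a product involves only the coefficients of the factors up to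
  \<open>n\<close>.\<close>

lemma tendsto_fps_mult:
  fixes f g :: "nat \<Rightarrow> rat fps"
  assumes "f \<longlonglongrightarrow> a" "g \<longlonglongrightarrow> b"
  shows "(\<lambda>n. f n * g n) \<longlonglongrightarrow> a * b"
proof (rule tendsto_fpsI)
  fix n
  have "\<forall>\<^sub>F L in sequentially. \<forall>i\<in>{..n}. f L $ i = a $ i"
    "\<forall>\<^sub>F L in sequentially. \<forall>i\<in>{..n}. g L $ i = b $ i"
    using assms by (auto simp: tendsto_fps_iff intro!: eventually_ball_finite)
  then show "\<forall>\<^sub>F L in sequentially. (f L * g L) $ n = (a * b) $ n"
    by eventually_elim (auto intro!: fps_mult_nth_cong)
qed

lemma prodinf_fps_mult:
  assumes "fps_near_one f" "fps_near_one g"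
  shows "prodinf f * prodinf g = (\<Prod>k. f k * g k)"
proof (rule LIMSEQ_unique)
  show "(\<lambda>L. \<Prod>k<L. f k * g k) \<longlonglongrightarrow> prodinf f * prodinf g"
    using fps_near_one_has_prod(2)[OF assms(1)] fps_near_one_has_prod(2)[OF assms(2)]
    by (simp add: prod.distrib tendsto_fps_mult)
  show "(\<lambda>L. \<Prod>k<L. f k * g k) \<longlonglongrightarrow> (\<Prod>k. f k * g k)"
    by (intro fps_near_one_has_prod near_one assms)
qed

lemma prodinf_fps_divide:
  assumes "fps_near_one f" "fps_near_one g"
  shows "prodinf f / prodinf g = (\<Prod>k. f k / g k)"
proof -
  have "(\<Prod>k. f k / g k) * prodinf g = (\<Prod>k. f k / g k * g k)"
    by (intro prodinf_fps_mult near_one assms)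
  also have "(\<lambda>k. f k / g k * g k) = f"
    using fps_near_one_nz[OF assms(2)] by (simp add: fps_divide_unit mult.assoc inverse_mult_eq_1)
  finally show ?thesis
    using fps_near_one_has_prod(3)[OF assms(2)] by (metis nonzero_mult_div_cancel_right)
qed

section \<open>Even and odd parts of an infinite product, and Euler's theorem on odd and distinct
  parts\<close>

lemma prodinf_even_part:
  fixes f :: "nat \<Rightarrow> rat fps"
  assumes "fps_near_one f"
  shows "(\<Prod>k. if even (Suc k) then f k else 1) = (\<Prod>k. f (Suc (2 * k)))"
proof (rule LIMSEQ_unique)
  let ?g = "\<lambda>k. if even (Suc k) then f k else 1"
  \<comment> \<open>Indices start at 0, so among the first \<open>2 * L\<close> the values
    \<open>f k\<close> are kept at \<open>k = 1, 3, ..., 2 * L - 1\<close>.\<close>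
  have "(\<Prod>k<2 * L. ?g k) = (\<Prod>k<L. f (Suc (2 * k)))" for L
    by (induction L) auto
  moreover have "(\<lambda>L. \<Prod>k<2 * L. ?g k) \<longlonglongrightarrow> prodinf ?g"
    using LIMSEQ_subseq_LIMSEQ[OF fps_near_one_has_prod(2), of ?g "\<lambda>L. 2 * L"] assms
    by (simp add: near_one strict_mono_def o_def)
  ultimately show "(\<lambda>L. \<Prod>k<L. f (Suc (2 * k))) \<longlonglongrightarrow> prodinf ?g"
    by simp
  have "fps_near_one (\<lambda>k. f (Suc (2 * k)))"
    using assms by (auto simp: fps_near_one_def)
  then show "(\<lambda>L. \<Prod>k<L. f (Suc (2 * k))) \<longlonglongrightarrow> (\<Prod>k. f (Suc (2 * k)))"
    by (rule fps_near_one_has_prod)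
qed

lemma one_minus_X_even:
  "1 - fps_X ^ Suc (Suc (2 * k)) = (1 - fps_X ^ Suc k) * (1 + fps_X ^ Suc k :: rat fps)"
proof -
  have "fps_X ^ Suc (Suc (2 * k)) = fps_X ^ Suc k * (fps_X ^ Suc k :: rat fps)"
    by (simp only: mult_2 add_Suc add_Suc_right flip: power_add)
  then show ?thesis
    by (simp only: left_diff_distrib distrib_left mult_1 mult_1_right) simp
qed

lemma prodinf_geometric_even:
  "(\<Prod>k. if even (Suc k) then 1 / (1 - fps_X ^ Suc k) else (1 :: rat fps)) =
     (\<Prod>k. 1 / ((1 - fps_X ^ Suc k) * (1 + fps_X ^ Suc k)))"
proof -
  have "fps_near_one (\<lambda>k. 1 / (1 - fps_X ^ Suc k))"
    by (intro near_one)
  from prodinf_even_part[OF this] show ?thesis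
    by (simp only: one_minus_X_even)
qed

text \<open>The odd and the even factors together give the product of all
  \<open>1 / (1 - x^k)\<close>. Factoring \<open>1 - x^(2 k)\<close> shows that the even factors
  times all \<open>1 + x^k\<close> give the same product, and the even part cancels.\<close>

lemma prodinf_geometric_odd:
  "(\<Prod>k. if odd (Suc k) then 1 / (1 - fps_X ^ Suc k) else (1 :: rat fps)) = (\<Prod>k. 1 + fps_X ^ Suc k)"
    (is "prodinf ?o = prodinf ?p")
proof -
  let ?e = "\<lambda>k. if even (Suc k) then 1 / (1 - fps_X ^ Suc k) else (1 :: rat fps)"
  let ?u = "\<lambda>k. 1 - fps_X ^ Suc k :: rat fps"
  have near: "fps_near_one ?o" "fps_near_one ?e" "fps_near_one ?p"
      "fps_near_one (\<lambda>k. 1 / (?u k * ?p k))"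
    by (intro near_one)+
  have "prodinf ?o * prodinf ?e = (\<Prod>k. 1 / ?u k)"
    by (subst prodinf_fps_mult[OF near(1,2)]) (rule arg_cong[where f = prodinf], auto)
  also have "1 / ?u k = ?p k * (1 / (?u k * ?p k))" for k
  proof -
    have "?p k * (1 / (?u k * ?p k)) = inverse (?u k) * (?p k * inverse (?p k))"
      by (simp add: fps_divide_unit fps_inverse_mult)
    then show ?thesis
      by (simp add: fps_divide_unit inverse_mult_eq_1')
  qed
  then have "(\<Prod>k. 1 / ?u k) = prodinf ?p * prodinf ?e"
    unfolding prodinf_geometric_even by (subst prodinf_fps_mult[OF near(3,4)]) (rule arg_cong[where f = prodinf], blast)
  finally show ?thesis
    using fps_near_one_has_prod(3)[OF near(2)] by simp
qed

subsection \<open>Diagrams as families of tuples\<close>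

lemma filled_rowD:
  assumes "filled_row \<epsilon> m r"
  shows "r \<noteq> []" "length r > 0" "hd r \<in> {1..m}" "set r \<subseteq> {1..m}"
  using assms unfolding filled_row_def by (blast, blast, meson hd_in_set subsetD, blast)

text \<open>The value \<open>m\<close> is split off because it represents the class of 0; below it,
  distinct numbers have distinct remainders.\<close>

lemma cong_in_range_eq:
  assumes "x \<in> {1..m}" "y \<in> {1..m}" "[x = y] (mod m)"
  shows "x = (y::nat)"
proof (cases "x = m \<or> y = m")
  case True
  then have "m dvd x \<and> m dvd y"
    using assms(3) by (metis cong_dvd_iff dvd_refl)
  then show ?thesis
    using assms(1,2) by (metis atLeastAtMost_iff dvd_imp_le le_antisym less_le_trans zero_less_one)
next
  case False
  then show ?thesis
    using assms by (auto simp: cong_def)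
qed

text \<open>Representatives are taken in \<open>{1..m}\<close>, as for the entries of boxes, so the
  class of 0 is represented by \<open>m\<close>.\<close>

definition residue :: "nat \<Rightarrow> nat \<Rightarrow> nat" where
  "residue m y = (if y mod m = 0 then m else y mod m)"

lemma residue:
  assumes "m > 0"
  shows "residue m y \<in> {1..m}" "[residue m y = y] (mod m)"
  using assms by (auto simp: residue_def cong_def Suc_le_eq intro: less_imp_le)

lemma eq_residue_iff:
  assumes "m > 0" "x \<in> {1..m}"
  shows "x = residue m y \<longleftrightarrow> [x = y] (mod m)"
  by (metis assms cong_in_range_eq cong_sym cong_trans residue)

text \<open>For either sign an entry fixes the next one modulo \<open>m\<close>, and
  \<open>{1..m}\<close> meets each residue class once.\<close>

lemma filled_row_unique:
  assumes "filled_row \<epsilon> m r" "filled_row \<epsilon> m s" "length r = length s" "hd r = hd s"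
  shows "r = s"
proof (rule nth_equalityI[OF assms(3)])
  fix i assume "i < length r"
  then show "r ! i = s ! i"
  proof (induction i)
    case 0
    then show ?case using assms filled_rowD(1) by (metis hd_conv_nth)
  next
    case (Suc i)
    then have "Suc i < length s" using assms(3) by simp
    have "r ! i = s ! i" using Suc by simp
    have "r ! Suc i \<in> {1..m}" "s ! Suc i \<in> {1..m}"
      using \<open>Suc i < length s\<close> Suc.prems filled_rowD(4) assms(1,2) by (meson nth_mem subsetD)+
    moreover
    have "[r ! Suc i = s ! Suc i] (mod m)"
    proof (cases \<epsilon>)
      case Plus
      then have "[r ! i = r ! Suc i + 1] (mod m)" "[s ! i = s ! Suc i + 1] (mod m)"
        using assms(1,2) Suc.prems \<open>Suc i < length s\<close> by (simp_all add: filled_row_def)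
      then have "[r ! Suc i + 1 = s ! Suc i + 1] (mod m)"
        using \<open>r ! i = s ! i\<close> by (metis cong_sym cong_trans)
      then show ?thesis by (simp only: cong_add_rcancel_nat)
    next
      case Minus
      then have "[r ! Suc i = r ! i + 1] (mod m)" "[s ! Suc i = s ! i + 1] (mod m)"
        using assms(1,2) Suc.prems \<open>Suc i < length s\<close> by (simp_all add: filled_row_def)
      then show ?thesis
        using \<open>r ! i = s ! i\<close> by (metis cong_sym cong_trans)
    qed
    ultimately show ?case
      by (rule cong_in_range_eq)
  qed
qed

lemma filled_row_exists:
  assumes "m > 0" "j \<in> {1..m}" "len > 0"
  shows "\<exists>r. filled_row \<epsilon> m r \<and> length r = len \<and> hd r = j"
  using assms(3,2)
proof (induction len arbitrary: j rule: nat_induct_non_zero)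
  case 1
  then show ?case
    by (intro exI[of _ "[j]"]) (simp add: filled_row_def)
next
  case (Suc len)
  \<comment> \<open>The entry that must follow \<open>j\<close>. As \<open>j\<close> is at least 1,
    \<open>j - 1\<close> is exact, and \<open>residue\<close> turns the value 0 into
    \<open>m\<close>.\<close>
  define j' where "j' = residue m (case \<epsilon> of Plus \<Rightarrow> j - 1 | Minus \<Rightarrow> j + 1)"
  have j': "j' \<in> {1..m}"
    unfolding j'_def by (rule residue[OF assms(1)])
  have step: "case \<epsilon> of Plus \<Rightarrow> [j = j' + 1] (mod m) | Minus \<Rightarrow> [j' = j + 1] (mod m)"
  proof (cases \<epsilon>)
    case Plus
    then have "[j' = j - 1] (mod m)"
      using residue(2)[OF assms(1)] by (simp add: j'_def)
    then have "[j' + 1 = j - 1 + 1] (mod m)"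
      by (simp only: cong_add_rcancel_nat)
    then show ?thesis
      using Plus Suc.prems by (simp add: cong_sym)
  next
    case Minus
    then show ?thesis
      using residue(2)[OF assms(1)] by (simp add: j'_def)
  qed
  obtain r where r: "filled_row \<epsilon> m r" "length r = len" "hd r = j'"
    using Suc.IH[OF j'] by blast
  have "filled_row \<epsilon> m (j # r)"
    unfolding filled_row_def
  proof (intro conjI allI impI)
    fix i assume i: "Suc i < length (j # r)"
    show "case \<epsilon> of
           Plus \<Rightarrow> [(j # r) ! i = (j # r) ! Suc i + 1] (mod m)
         | Minus \<Rightarrow> [(j # r) ! Suc i = (j # r) ! i + 1] (mod m)"
    proof (cases i)
      case 0
      then show ?thesis
        using step r filled_rowD(1)[OF r(1)] by (cases \<epsilon>) (simp_all add: hd_conv_nth)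
    next
      case (Suc n)
      then show ?thesis
        using r(1) i by (cases \<epsilon>) (simp_all add: filled_row_def)
    qed
  qed (use Suc.prems filled_rowD[OF r(1)] in auto)
  with r show ?case by (intro exI[of _ "j # r"]) simp
qed

text \<open>By uniqueness, all rows of \<open>Y\<close> with this length and beginning entry are
  copies of \<open>r\<close>.\<close>

lemma mult_eq_count:
  assumes "Y \<in> young_diagrams \<epsilon> m" "filled_row \<epsilon> m r"
  shows "mult Y (length r) (hd r) = count Y r"
proof -
  have "{#s \<in># Y. length s = length r \<and> hd s = hd r#} = {#s \<in># Y. s = r#}"
    using assms filled_row_unique by (intro filter_mset_cong) (auto simp: young_diagrams_def)
  then show ?thesis
    by (simp add: mult_def filter_eq_replicate_mset)
qed

lemma mult_eq_0: "len \<notin> row_lengths Y \<Longrightarrow> mult Y len j = 0"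
  by (auto simp: mult_def row_lengths_def)

text \<open>Adding a row raises exactly one multiplicity by 1, the one at its length and beginning
  entry. Lengths in \<open>\<Lambda>\<close> that do not occur contribute 0.\<close>

lemma boxes_eq_sum_mult:
  assumes "Y \<in> young_diagrams \<epsilon> m" "row_lengths Y \<subseteq> \<Lambda>" "finite \<Lambda>"
  shows "boxes Y = (\<Sum>len\<in>\<Lambda>. len * (\<Sum>j = 1..m. mult Y len j))"
  using assms(1,2)
proof (induction Y)
  case empty
  then show ?case by (simp add: boxes_def mult_def)
next
  case (add r Y)
  have r: "hd r \<in> {1..m}" "length r \<in> \<Lambda>"
    using add.prems filled_rowD(3) by (auto simp: young_diagrams_def row_lengths_def)
  have "mult (add_mset r Y) len j = mult Y len j + (if length r = len then if hd r = j then 1 else 0 else 0)"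
    for len j by (simp add: mult_def)
  then have "(\<Sum>len\<in>\<Lambda>. len * (\<Sum>j = 1..m. mult (add_mset r Y) len j)) =
     (\<Sum>len\<in>\<Lambda>. len * (\<Sum>j = 1..m. mult Y len j)) +
     (\<Sum>len\<in>\<Lambda>. len * (\<Sum>j = 1..m. if length r = len then if hd r = j then 1 else 0 else 0))"
    by (simp only: sum.distrib distrib_left)
  also have "(\<Sum>len\<in>\<Lambda>. len * (\<Sum>j = 1..m. if length r = len then if hd r = j then 1 else 0 else 0)) =
     (\<Sum>len\<in>\<Lambda>. if length r = len then len else 0)"
    using r by (intro sum.cong) auto
  also have "\<dots> = length r"
    using r assms(3) by simp
  finally show ?case
    using add by (simp add: boxes_def young_diagrams_def row_lengths_def)
qed

lemma bij_betw_mult: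
  assumes "m > 0" "finite \<Lambda>" "0 \<notin> \<Lambda>"
  shows "bij_betw (\<lambda>Y. \<lambda>len\<in>\<Lambda>. \<lambda>j\<in>{1..m}. mult Y len j)
     {Y \<in> young_diagrams \<epsilon> m. row_lengths Y \<subseteq> \<Lambda>} (Pi\<^sub>E \<Lambda> (\<lambda>_. Pi\<^sub>E {1..m} (\<lambda>_. UNIV)))"
  (is "bij_betw ?h ?S ?T")
proof (rule bij_betw_imageI)
  show "inj_on ?h ?S"
  proof (rule inj_onI)
    fix Y Z assume Y: "Y \<in> ?S" and Z: "Z \<in> ?S" and eq: "?h Y = ?h Z"
    show "Y = Z"
    proof (rule multiset_eqI)
      fix r
      show "count Y r = count Z r"
      proof (cases "filled_row \<epsilon> m r \<and> length r \<in> \<Lambda>")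
        case True
        then have "?h Y (length r) (hd r) = mult Y (length r) (hd r)"
          "?h Z (length r) (hd r) = mult Z (length r) (hd r)"
          using filled_rowD(3) by auto
        then have "mult Y (length r) (hd r) = mult Z (length r) (hd r)"
          by (simp only: eq)
        then show ?thesis
          using True Y Z by (simp add: mult_eq_count[where \<epsilon> = \<epsilon> and m = m])
      next
        case False
        then have "r \<notin># Y" "r \<notin># Z"
          using Y Z by (auto simp: young_diagrams_def row_lengths_def)
        then show ?thesis by (simp add: not_in_iff)
      qed
    qed
  qed
  show "?h ` ?S = ?T"
  proof (intro subset_antisym subsetI)
    fix f assume f: "f \<in> ?T"
    \<comment> \<open>The multiplicity function of the diagram sought: a row is taken as often as
      \<open>f\<close> prescribes for its length and beginning entry. Its support is finite since
      lengths are at most \<open>Max \<Lambda>\<close>.\<close>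
    define g where "g r = (if filled_row \<epsilon> m r \<and> length r \<in> \<Lambda> then f (length r) (hd r) else 0)" for r
    define Y where "Y = Abs_multiset g"
    have "{r. g r > 0} \<subseteq> {r. set r \<subseteq> {1..m} \<and> length r \<le> Max \<Lambda>}"
      using assms(2) filled_rowD(4) by (auto simp: g_def split: if_splits)
    then have "finite {r. g r > 0}"
      by (rule finite_subset) (rule finite_lists_length_le, simp)
    then have count: "count Y = g"
      unfolding Y_def by (rule count_Abs_multiset)
    have Y: "Y \<in> ?S"
      by (auto simp: young_diagrams_def row_lengths_def count g_def simp flip: count_greater_zero_iff
          split: if_splits)
    have "?h Y = f"
    proof (intro ext)
      fix len j
      \<comment> \<open>In the first two cases both sides have the default value of extensional
        functions; only the third concerns rows.\<close>
      consider "len \<notin> \<Lambda>" | "len \<in> \<Lambda>" "j \<notin> {1..m}" | "len \<in> \<Lambda>" "j \<in> {1..m}" by blast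
      then show "?h Y len j = f len j"
      proof cases
        case 1
        then show ?thesis by (simp add: PiE_arb[OF f 1])
      next
        case 2
        then show ?thesis
          by (simp add: PiE_arb[OF PiE_mem[OF f 2(1)] 2(2)] restrict_def del: atLeastAtMost_iff)
      next
        case 3
        have "len > 0" using 3 assms(3) by (metis gr0I)
        then obtain r where r: "filled_row \<epsilon> m r" "length r = len" "hd r = j"
          using filled_row_exists[OF assms(1) 3(2)] by blast
        have "?h Y len j = count Y r"
          using 3 r mult_eq_count[of Y \<epsilon> m r] Y by simp
        then show ?thesis
          using r 3 by (simp add: count g_def)
      qed
    qed
    with Y show "f \<in> ?h ` ?S" by blast
  qed auto
qed

text \<open>Under the bijection with families of tuples, condition and weight both split by row
  length. Finiteness of \<open>\<Lambda>\<close> keeps the product finite; infinitely many lengths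
  are reached coefficient by coefficient later.\<close>

lemma gf_diagrams:
  fixes C :: "nat \<Rightarrow> (nat \<Rightarrow> nat) \<Rightarrow> bool"
  defines "P \<equiv> \<lambda>m len. {p \<in> Pi\<^sub>E {1..m} (\<lambda>_. UNIV). C len p}"
  assumes "m > 0" "finite \<Lambda>" "0 \<notin> \<Lambda>" and "\<And>len. len \<in> \<Lambda> \<Longrightarrow> finite_fibres (P m len) (v len)"
  shows "gf {Y \<in> young_diagrams \<epsilon> m. row_lengths Y \<subseteq> \<Lambda> \<and> (\<forall>len\<in>\<Lambda>. C len (\<lambda>j\<in>{1..m}. mult Y len j))}
      (\<lambda>Y. \<Sum>len\<in>\<Lambda>. v len (\<lambda>j\<in>{1..m}. mult Y len j)) = (\<Prod>len\<in>\<Lambda>. gf (P m len) (v len))"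
proof -
  let ?h = "\<lambda>Y. \<lambda>len\<in>\<Lambda>. \<lambda>j\<in>{1..m}. mult Y len j"
  have "bij_betw ?h
      {Y \<in> {Y \<in> young_diagrams \<epsilon> m. row_lengths Y \<subseteq> \<Lambda>}. \<forall>len\<in>\<Lambda>. C len (\<lambda>j\<in>{1..m}. mult Y len j)}
      {f \<in> Pi\<^sub>E \<Lambda> (\<lambda>_. Pi\<^sub>E {1..m} (\<lambda>_. UNIV)). \<forall>len\<in>\<Lambda>. C len (f len)}"
    by (rule bij_betw_Collect[OF bij_betw_mult[OF assms(2-4)]]) simp
  also have "{f \<in> Pi\<^sub>E \<Lambda> (\<lambda>_. Pi\<^sub>E {1..m} (\<lambda>_. UNIV)). \<forall>len\<in>\<Lambda>. C len (f len)} = Pi\<^sub>E \<Lambda> (P m)"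
    unfolding P_def PiE_def Pi_def by blast
  finally have "gf {Y \<in> {Y \<in> young_diagrams \<epsilon> m. row_lengths Y \<subseteq> \<Lambda>}. \<forall>len\<in>\<Lambda>. C len (\<lambda>j\<in>{1..m}. mult Y len j)}
      (\<lambda>Y. \<Sum>len\<in>\<Lambda>. v len (\<lambda>j\<in>{1..m}. mult Y len j)) = gf (Pi\<^sub>E \<Lambda> (P m)) (\<lambda>f. \<Sum>len\<in>\<Lambda>. v len (f len))"
    by (rule gf_bij_betw) (simp add: restrict_def)
  also have "\<dots> = (\<Prod>len\<in>\<Lambda>. gf (P m len) (v len))"
    by (rule gf_PiE) (use assms in auto)
  finally show ?thesis by simp
qed

subsection \<open>Symmetric and aperiodic tuples\<close>

text \<open>\<open>\<sigma>\<close> exchanges the smaller and the larger members of the two-element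
  orbits, so each such orbit is represented by its smaller member, counted twice.\<close>

lemma sum_involution:
  fixes J :: "nat set" and g :: "nat \<Rightarrow> nat"
  assumes "finite J" "\<And>a. a \<in> J \<Longrightarrow> \<sigma> a \<in> J \<and> \<sigma> (\<sigma> a) = a" "\<And>a. a \<in> J \<Longrightarrow> g (\<sigma> a) = g a"
  shows "(\<Sum>a\<in>J. g a) = (\<Sum>a | a \<in> J \<and> a \<le> \<sigma> a. if \<sigma> a = a then g a else 2 * g a)"
proof -
  define F R R' where "F = {a \<in> J. \<sigma> a = a}" and "R = {a \<in> J. a < \<sigma> a}" and "R' = {a \<in> J. \<sigma> a < a}"
  have fin: "finite F" "finite R" "finite R'"
    using assms(1) by (auto simp: F_def R_def R'_def)
  have "J = F \<union> R \<union> R'"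
    by (auto simp: F_def R_def R'_def)
  then have "(\<Sum>a\<in>J. g a) = sum g (F \<union> R \<union> R')"
    by simp
  also have "\<dots> = sum g F + sum g R + sum g R'"
    by (subst sum.union_disjoint; (subst sum.union_disjoint)?) (use fin in \<open>auto simp: F_def R_def R'_def\<close>)
  also have "sum g R' = sum g R"
    by (rule sum.reindex_bij_witness[of _ \<sigma> \<sigma>]) (use assms in \<open>auto simp: R_def R'_def\<close>)
  finally have "(\<Sum>a\<in>J. g a) = sum g F + (\<Sum>a\<in>R. 2 * g a)"
    by (simp add: mult_2 sum.distrib)
  also have "\<dots> = (\<Sum>a\<in>F. if \<sigma> a = a then g a else 2 * g a) + (\<Sum>a\<in>R. if \<sigma> a = a then g a else 2 * g a)"
    by (intro arg_cong2[of _ _ _ _ "(+)"] sum.cong) (auto simp: F_def R_def)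
  also have "\<dots> = (\<Sum>a\<in>F \<union> R. if \<sigma> a = a then g a else 2 * g a)"
    by (subst sum.union_disjoint) (use fin in \<open>auto simp: F_def R_def\<close>)
  also have "F \<union> R = {a. a \<in> J \<and> a \<le> \<sigma> a}"
    by (auto simp: F_def R_def)
  finally show ?thesis .
qed

definition symmetric_tuples :: "nat set \<Rightarrow> (nat \<Rightarrow> nat) \<Rightarrow> (nat \<Rightarrow> nat) set" where
  "symmetric_tuples J \<sigma> = {p \<in> Pi\<^sub>E J (\<lambda>_. UNIV). (\<forall>a\<in>J. p (\<sigma> a) = p a) \<and>
     (\<forall>a\<in>J. \<sigma> a = a \<longrightarrow> even (p a)) \<and> (\<exists>a\<in>J. p a \<le> 1)}"

text \<open>A fixed point contributes an even entry to the sum and a pair contributes its common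
  entry twice, so half the sum is a sum of free parameters, one per orbit. By the last hypothesis
  \<open>d\<close> is the number of orbits.\<close>

lemma gf_symmetric_tuples:
  assumes J: "finite J" and \<sigma>: "\<And>a. a \<in> J \<Longrightarrow> \<sigma> a \<in> J \<and> \<sigma> (\<sigma> a) = a" and "c > 0"
    and d: "card J + card {a \<in> J. \<sigma> a = a} = 2 * d"
  shows "gf (symmetric_tuples J \<sigma>) (\<lambda>p. c * ((\<Sum>a\<in>J. p a) div 2)) =
      (1 - fps_X ^ (c * card J)) / (1 - fps_X ^ c) ^ d"
    and "finite_fibres (symmetric_tuples J \<sigma>) (\<lambda>p. c * ((\<Sum>a\<in>J. p a) div 2))"
    and "p \<in> symmetric_tuples J \<sigma> \<Longrightarrow> even (\<Sum>a\<in>J. p a)"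
proof -
  define D where "D = {a. a \<in> J \<and> a \<le> \<sigma> a}"
  \<comment> \<open>An entry is \<open>t\<close> times its parameter, and \<open>b\<close> is the
    orbit size. With these, \<open>q a < b a\<close> says exactly that the entry is at most 1. The
    map \<open>h\<close> reads off the parameters at the orbit minima in \<open>D\<close>;
    \<open>g\<close> restores the tuple from them.\<close>
  define t where "t a = (if \<sigma> a = a then 2 else 1 :: nat)" for a
  define b where "b a = (if \<sigma> a = a then 1 else 2 :: nat)" for a
  define h where "h p = (\<lambda>a\<in>D. p a div t a)" for p :: "nat \<Rightarrow> nat"
  define g where "g q = (\<lambda>a\<in>J. t a * q (min a (\<sigma> a)))" for q :: "nat \<Rightarrow> nat"
  let ?T = "symmetric_tuples J \<sigma>" and ?Q = "{q \<in> Pi\<^sub>E D (\<lambda>_. UNIV). \<exists>a\<in>D. q a < b a}"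
  have finD: "finite D" using J by (simp add: D_def)
  have min_D: "min a (\<sigma> a) \<in> D" if "a \<in> J" for a
    using \<sigma>[OF that] that by (auto simp: D_def min_def)
  have t_\<sigma>: "t (\<sigma> a) = t a" if "a \<in> J" for a
    using \<sigma>[OF that] by (auto simp: t_def)
  have t_min: "t (min a (\<sigma> a)) = t a" if "a \<in> J" for a
    using t_\<sigma>[OF that] by (simp add: min_def)
  have p_min: "p (min a (\<sigma> a)) = p a" if "p \<in> ?T" "a \<in> J" for p a
    using that by (simp add: symmetric_tuples_def min_def)
  have t_dvd: "t a * (p a div t a) = p a" if "p \<in> ?T" "a \<in> J" for p a
    using that by (auto simp: symmetric_tuples_def t_def)
  have less_b: "x < b a \<longleftrightarrow> t a * x \<le> 1" for x a
    by (auto simp: t_def b_def)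
  have bij: "bij_betw h ?T ?Q"
  proof (rule bij_betw_byWitness[where f' = g])
    show "\<forall>p\<in>?T. g (h p) = p"
    proof
      fix p assume p: "p \<in> ?T"
      have "g (h p) a = p a" if "a \<in> J" for a
      proof -
        have "g (h p) a = t a * (p (min a (\<sigma> a)) div t (min a (\<sigma> a)))"
          using that min_D[OF that] by (simp add: g_def h_def)
        then show ?thesis
          by (simp only: p_min[OF p that] t_min[OF that] t_dvd[OF p that])
      qed
      moreover have "g (h p) a = p a" if "a \<notin> J" for a
        using that PiE_arb[of p J "\<lambda>_. UNIV" a] p by (simp add: g_def symmetric_tuples_def)
      ultimately show "g (h p) = p" by blast
    qed
    show "\<forall>q\<in>?Q. h (g q) = q"
    proof
      fix q assume q: "q \<in> ?Q"
      have "h (g q) a = q a" if "a \<in> D" for a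
        using that by (simp add: g_def h_def D_def t_def min_def)
      moreover have "h (g q) a = q a" if "a \<notin> D" for a
        using that PiE_arb[of q D "\<lambda>_. UNIV" a] q by (simp add: h_def)
      ultimately show "h (g q) = q" by blast
    qed
    show "h ` ?T \<subseteq> ?Q"
    proof
      fix q assume "q \<in> h ` ?T"
      then obtain p where p: "p \<in> ?T" "q = h p" by blast
      then obtain a where a: "a \<in> J" "p a \<le> 1" by (auto simp: symmetric_tuples_def)
      \<comment> \<open>The small entry may sit at the larger point of its orbit; symmetry moves it
        to the representative.\<close>
      let ?a = "min a (\<sigma> a)"
      have "?a \<in> J" using min_D[OF a(1)] by (simp add: D_def)
      have "t ?a * q ?a = t ?a * (p ?a div t ?a)"
        using min_D[OF a(1)] by (simp add: p(2) h_def)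
      also have "\<dots> = p ?a"
        by (rule t_dvd[OF p(1) \<open>?a \<in> J\<close>])
      also have "\<dots> = p a"
        by (rule p_min[OF p(1) a(1)])
      finally have "q ?a < b ?a"
        unfolding less_b using a(2) by (simp only:)
      moreover have "q \<in> Pi\<^sub>E D (\<lambda>_. UNIV)" using p by (auto simp: h_def)
      ultimately show "q \<in> ?Q" using min_D[OF a(1)] by blast
    qed
    show "g ` ?Q \<subseteq> ?T"
    proof
      fix p assume "p \<in> g ` ?Q"
      then obtain q a where q: "p = g q" and a: "a \<in> D" "q a < b a" by blast
      have "p (\<sigma> a) = p a" if "a \<in> J" for a
        using t_\<sigma>[OF that] \<sigma>[OF that] that by (simp add: q g_def min.commute)
      moreover have "even (p a)" if "a \<in> J" "\<sigma> a = a" for a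
        using that by (simp add: q g_def t_def)
      moreover have "p \<in> Pi\<^sub>E J (\<lambda>_. UNIV)"
        by (simp add: q g_def)
      moreover have "a \<in> J" "p a \<le> 1"
        using a unfolding less_b by (simp_all add: q g_def D_def min_def)
      ultimately show "p \<in> ?T"
        unfolding symmetric_tuples_def by blast
    qed
  qed
  have sum: "(\<Sum>a\<in>J. p a) = 2 * (\<Sum>a\<in>D. h p a)" if p: "p \<in> ?T" for p
  proof -
    have "(\<Sum>a\<in>J. p a) = (\<Sum>a\<in>D. if \<sigma> a = a then p a else 2 * p a)"
      unfolding D_def by (rule sum_involution[OF J \<sigma>]) (use p in \<open>auto simp: symmetric_tuples_def\<close>)
    also have "\<dots> = (\<Sum>a\<in>D. 2 * h p a)"
    proof (rule sum.cong)
      fix a assume a: "a \<in> D"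
      then show "(if \<sigma> a = a then p a else 2 * p a) = 2 * h p a"
        using t_dvd[OF p, of a] by (simp add: h_def D_def) (simp add: t_def split: if_splits)
    qed simp
    finally show ?thesis by (simp add: sum_distrib_left)
  qed
  then have w: "c * (\<Sum>a\<in>D. h p a) = c * ((\<Sum>a\<in>J. p a) div 2)" if "p \<in> ?T" for p
    using that by simp
  have "card J = (\<Sum>a\<in>D. b a)"
    unfolding D_def b_def using sum_involution[OF J \<sigma>, of "\<lambda>_. 1"]
    by (simp only: card_eq_sum mult_1_right)
  moreover have "card D = d"
  proof -
    \<comment> \<open>Summing \<open>t\<close> over \<open>J\<close> gives 2 for every orbit: 2 at a
      fixed point, and 1 + 1 on a pair.\<close>
    have "2 * d = (\<Sum>a\<in>J. 1) + (\<Sum>a\<in>J. if \<sigma> a = a then 1 else 0)"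
      using J d by (simp flip: sum.inter_filter)
    also have "\<dots> = (\<Sum>a\<in>J. t a)"
      unfolding sum.distrib[symmetric] by (intro sum.cong) (auto simp: t_def)
    also have "\<dots> = (\<Sum>a\<in>D. if \<sigma> a = a then t a else 2 * t a)"
      unfolding D_def by (rule sum_involution[of J \<sigma> t, OF J \<sigma> t_\<sigma>])
    also have "\<dots> = (\<Sum>a\<in>D. 2)"
      by (intro sum.cong) (auto simp: t_def)
    finally show ?thesis by simp
  qed
  ultimately show "gf ?T (\<lambda>p. c * ((\<Sum>a\<in>J. p a) div 2)) = (1 - fps_X ^ (c * card J)) / (1 - fps_X ^ c) ^ d"
    using gf_bij_betw[of h ?T ?Q "\<lambda>q. c * (\<Sum>a\<in>D. q a)", OF bij w]
      gf_exists_less(1)[OF finD \<open>c > 0\<close>, of b] by simp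
  show "finite_fibres ?T (\<lambda>p. c * ((\<Sum>a\<in>J. p a) div 2))"
    using finite_fibres_bij_betw[of h ?T ?Q "\<lambda>q. c * (\<Sum>a\<in>D. q a)", OF bij w]
      gf_exists_less(2)[OF finD \<open>c > 0\<close>, of b] by simp
  show "even (\<Sum>a\<in>J. p a)" if "p \<in> ?T"
    using sum[OF that] by simp
qed

text \<open>A product of naturals vanishes iff some factor does. For \<open>d dvd m\<close> the
  indices \<open>i + k * d\<close> run through a residue class modulo \<open>d\<close>, so every
  class must contain a zero entry.\<close>

definition aperiodic_tuples :: "nat \<Rightarrow> nat \<Rightarrow> (nat \<Rightarrow> nat) set" where
  "aperiodic_tuples d m =
     {p \<in> Pi\<^sub>E {1..m} (\<lambda>_. UNIV). \<forall>i\<in>{1..d}. (\<Prod>k = 0..m div d - 1. p (i + k * d)) = 0}"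

text \<open>Division with remainder of \<open>j - 1\<close> by \<open>d\<close>, shifted by one
  because indices start at 1.\<close>

lemma bij_betw_add_mult:
  fixes d m :: nat
  assumes "d > 0" "d dvd m"
  shows "bij_betw (\<lambda>(i, k). i + k * d) ({1..d} \<times> {0..<m div d}) {1..m}"
proof -
  define f where "f = (\<lambda>(i, k). i + k * d)"
  define g where "g j = (Suc ((j - 1) mod d), (j - 1) div d)" for j :: nat
  obtain e where m: "m = d * e" using assms(2) by blast
  have e: "m div d = e" using assms m by simp
  have "bij_betw f ({1..d} \<times> {0..<e}) {1..m}"
  proof (rule bij_betwI[where g = g])
    show "f \<in> {1..d} \<times> {0..<e} \<rightarrow> {1..m}"
    proof
      fix x assume "x \<in> {1..d} \<times> {0..<e}"
      then obtain i k where ik: "x = (i, k)" "1 \<le> i" "i \<le> d" "k < e"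
        by auto
      have "i + k * d \<le> Suc k * d" using ik by simp
      also have "\<dots> \<le> e * d" using ik by (intro mult_le_mono1) simp
      finally show "f x \<in> {1..m}" using ik m by (simp add: f_def mult.commute)
    qed
    show "g \<in> {1..m} \<rightarrow> {1..d} \<times> {0..<e}"
      using assms(1) m by (auto simp: g_def Suc_le_eq less_mult_imp_div_less mult.commute)
    show "g (f x) = x" if "x \<in> {1..d} \<times> {0..<e}" for x
    proof -
      obtain i k where ik: "x = (Suc i, k)" "i < d"
        using \<open>x \<in> _\<close> by (metis One_nat_def Suc_le_D Suc_le_eq atLeastAtMost_iff mem_Sigma_iff surj_pair)
      then show ?thesis by (simp add: f_def g_def)
    qed
    show "f (g j) = j" if "j \<in> {1..m}" for j
      using that by (simp add: f_def g_def)
  qed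
  then show ?thesis unfolding f_def e .
qed

lemma bij_betw_curry_PiE:
  fixes g :: "'a \<times> 'b \<Rightarrow> 'c"
  assumes "bij_betw g (I \<times> K) J"
  shows "bij_betw (\<lambda>p :: 'c \<Rightarrow> 'd. \<lambda>i\<in>I. \<lambda>k\<in>K. p (g (i, k)))
     (Pi\<^sub>E J (\<lambda>_. UNIV)) (Pi\<^sub>E I (\<lambda>_. Pi\<^sub>E K (\<lambda>_. UNIV)))"
proof -
  define f where "f p = (\<lambda>i\<in>I. \<lambda>k\<in>K. p (g (i, k)))" for p :: "'c \<Rightarrow> 'd"
  define h where "h q = (\<lambda>j\<in>J. case the_inv_into (I \<times> K) g j of (i, k) \<Rightarrow> q i k)" for q :: "'a \<Rightarrow> 'b \<Rightarrow> 'd"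
  have inj: "inj_on g (I \<times> K)" and J: "J = g ` (I \<times> K)"
    using assms by (auto simp: bij_betw_def)
  have h: "h q (g (i, k)) = q i k" if "i \<in> I" "k \<in> K" for q i k
    using the_inv_into_f_f[OF inj, of "(i, k)"] that J by (simp add: h_def)
  have "bij_betw f (Pi\<^sub>E J (\<lambda>_. UNIV)) (Pi\<^sub>E I (\<lambda>_. Pi\<^sub>E K (\<lambda>_. UNIV)))"
  proof (rule bij_betwI[where g = h])
    fix p :: "'c \<Rightarrow> 'd" assume p: "p \<in> Pi\<^sub>E J (\<lambda>_. UNIV)"
    show "h (f p) = p"
    proof
      fix j
      show "h (f p) j = p j"
      proof (cases "j \<in> J")
        case True
        then obtain i k where "i \<in> I" "k \<in> K" "j = g (i, k)" using J by blast
        then show ?thesis by (simp add: h) (simp add: f_def)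
      next
        case False
        then show ?thesis by (simp add: PiE_arb[OF p] h_def)
      qed
    qed
  next
    fix q :: "'a \<Rightarrow> 'b \<Rightarrow> 'd" assume q: "q \<in> Pi\<^sub>E I (\<lambda>_. Pi\<^sub>E K (\<lambda>_. UNIV))"
    show "f (h q) = q"
    proof (intro ext)
      fix i k
      consider "i \<notin> I" | "i \<in> I" "k \<notin> K" | "i \<in> I" "k \<in> K" by blast
      then show "f (h q) i k = q i k"
      proof cases
        case 1
        then show ?thesis by (simp add: f_def PiE_arb[OF q 1])
      next
        case 2
        then show ?thesis by (simp add: f_def PiE_arb[OF PiE_mem[OF q 2(1)] 2(2)])
      next
        case 3
        then show ?thesis by (simp add: f_def h)
      qed
    qed
  qed (auto simp: f_def h_def)
  then show ?thesis unfolding f_def .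
qed

text \<open>Currying splits the tuple into \<open>d\<close> independent blocks of
  \<open>m div d\<close> entries, one per residue class. Each block has an entry below 1, so the
  series is the \<open>d\<close>-th power of that of one block.\<close>

lemma gf_aperiodic_tuples:
  assumes "d > 0" "d dvd m" "m > 0" "c > 0"
  shows "gf (aperiodic_tuples d m) (\<lambda>p. c * (\<Sum>j = 1..m. p j)) =
      (1 - fps_X ^ (c * (m div d))) ^ d / (1 - fps_X ^ c) ^ m"
    and "finite_fibres (aperiodic_tuples d m) (\<lambda>p. c * (\<Sum>j = 1..m. p j))"
proof -
  define e where "e = m div d"
  have e: "e > 0" "m = d * e" using assms by (auto simp: e_def)
  let ?K = "{0..<e}" and ?g = "\<lambda>(i, k). i + k * d"
  let ?h = "\<lambda>p. \<lambda>i\<in>{1..d}. \<lambda>k\<in>?K. p (?g (i, k))"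
  let ?Q = "{q \<in> Pi\<^sub>E ?K (\<lambda>_. UNIV). \<exists>k\<in>?K. q k < (1::nat)}"
  have g: "bij_betw ?g ({1..d} \<times> ?K) {1..m}"
    unfolding e_def by (rule bij_betw_add_mult[OF assms(1,2)])
  have K: "{0..m div d - 1} = ?K"
    unfolding e_def[symmetric] using e(1) by auto
  have "bij_betw ?h {p \<in> Pi\<^sub>E {1..m} (\<lambda>_. UNIV). \<forall>i\<in>{1..d}. (\<Prod>k = 0..m div d - 1. p (i + k * d)) = 0}
      {q \<in> Pi\<^sub>E {1..d} (\<lambda>_. Pi\<^sub>E ?K (\<lambda>_. UNIV)). \<forall>i\<in>{1..d}. \<exists>k\<in>?K. q i k < (1::nat)}"
    unfolding K by (rule bij_betw_Collect[OF bij_betw_curry_PiE[OF g]]) simp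
  moreover have "{q \<in> Pi\<^sub>E {1..d} (\<lambda>_. Pi\<^sub>E ?K (\<lambda>_. UNIV)). \<forall>i\<in>{1..d}. \<exists>k\<in>?K. q i k < (1::nat)} =
      Pi\<^sub>E {1..d} (\<lambda>_. ?Q)"
    unfolding PiE_def Pi_def by blast
  ultimately have bij: "bij_betw ?h (aperiodic_tuples d m) (Pi\<^sub>E {1..d} (\<lambda>_. ?Q))"
    unfolding aperiodic_tuples_def by simp
  have w: "(\<Sum>i = 1..d. c * (\<Sum>k\<in>?K. ?h p i k)) = c * (\<Sum>j = 1..m. p j)" for p
  proof -
    have "(\<Sum>i = 1..d. c * (\<Sum>k\<in>?K. ?h p i k)) = c * (\<Sum>i = 1..d. \<Sum>k\<in>?K. p (?g (i, k)))"
      by (simp add: sum_distrib_left)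
    also have "(\<Sum>i = 1..d. \<Sum>k\<in>?K. p (?g (i, k))) = (\<Sum>x\<in>{1..d} \<times> ?K. p (?g x))"
      by (simp add: sum.cartesian_product case_prod_unfold)
    also have "\<dots> = (\<Sum>j = 1..m. p j)"
      by (rule sum.reindex_bij_betw[OF g])
    finally show ?thesis .
  qed
  have ff: "finite_fibres ?Q (\<lambda>q. c * (\<Sum>k\<in>?K. q k))"
    and gf: "gf ?Q (\<lambda>q. c * (\<Sum>k\<in>?K. q k)) = (1 - fps_X ^ (c * e)) / (1 - fps_X ^ c) ^ e"
    using gf_exists_less[of ?K c "\<lambda>_. 1"] assms by simp_all
  note PiE = gf_PiE[of "{1..d}" "\<lambda>_. ?Q" "\<lambda>_ q. c * (\<Sum>k\<in>?K. q k)", OF _ ff, simplified gf]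
  have "(1 - fps_X ^ c :: rat fps) $ 0 \<noteq> 0"
    using assms by simp
  then have "((1 - fps_X ^ c) ^ n :: rat fps) $ 0 \<noteq> 0" for n
    using assms by (simp add: fps_power_zeroth)
  then have "((1 - fps_X ^ (c * e)) / (1 - fps_X ^ c) ^ e) ^ d = (1 - fps_X ^ (c * e)) ^ d / ((1 - fps_X ^ c) ^ m :: rat fps)"
    by (simp add: fps_divide_unit power_mult_distrib fps_inverse_power e(2) power_mult[symmetric] mult.commute)
  then show "gf (aperiodic_tuples d m) (\<lambda>p. c * (\<Sum>j = 1..m. p j)) =
      (1 - fps_X ^ (c * (m div d))) ^ d / (1 - fps_X ^ c) ^ m"
    using gf_bij_betw[of ?h _ _ "\<lambda>q. \<Sum>i = 1..d. c * (\<Sum>k\<in>?K. q i k)", OF bij w] PiE(1)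
    by (simp add: e_def)
  show "finite_fibres (aperiodic_tuples d m) (\<lambda>p. c * (\<Sum>j = 1..m. p j))"
    using finite_fibres_bij_betw[of ?h _ _ "\<lambda>q. \<Sum>i = 1..d. c * (\<Sum>k\<in>?K. q i k)", OF bij w] PiE(2)
    by simp
qed

subsection \<open>Infinite product expansions\<close>

lemma sum_fps_X_nth: "(\<Sum>i<L. of_nat (c i) * fps_X ^ i :: rat fps) $ n = (if n < L then of_nat (c n) else 0)"
proof -
  have "(of_nat (c i) * fps_X ^ i :: rat fps) $ n = (if n = i then of_nat (c i) else 0)" for i
    by (simp add: fps_X_power_mult_right_nth fps_of_nat[symmetric] del: fps_of_nat)
  then show ?thesis
    by (simp add: fps_sum_nth)
qed

lemma length_le_boxes: "r \<in># Y \<Longrightarrow> length r \<le> boxes Y"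
  unfolding boxes_def by (metis insert_DiffM image_mset_add_mset sum_mset.add_mset le_add1)

lemma dvd_boxes: "\<forall>len\<in>row_lengths Y. a dvd len \<Longrightarrow> a dvd boxes Y"
  unfolding boxes_def row_lengths_def by (induction Y) auto

lemma row_lengths_pos: "Y \<in> young_diagrams \<epsilon> m \<Longrightarrow> len \<in> row_lengths Y \<Longrightarrow> len > 0"
  by (auto simp: young_diagrams_def row_lengths_def filled_row_def)

text \<open>The common frame of (i) and (ii): \<open>a\<close> divides all row lengths and
  \<open>e\<close> divides the sum of each admissible tuple, so boxes are counted in units of
  \<open>a * e\<close>. Part (i) takes \<open>e = 1\<close>, part (ii) takes \<open>a = 1\<close>
  and \<open>e = 2\<close>.\<close>

lemma sums_diagrams:
  fixes C :: "nat \<Rightarrow> (nat \<Rightarrow> nat) \<Rightarrow> bool"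
  assumes "m > 0" "a > 0" "e > 0"
    and P: "\<And>k. P k = {p \<in> Pi\<^sub>E {1..m} (\<lambda>_. UNIV). C (a * Suc k) p}"
    and gf: "\<And>k. gf (P k) (\<lambda>p. Suc k * ((\<Sum>j = 1..m. p j) div e)) = F k"
    and ff: "\<And>k. finite_fibres (P k) (\<lambda>p. Suc k * ((\<Sum>j = 1..m. p j) div e))"
    and dvd: "\<And>k p. p \<in> P k \<Longrightarrow> e dvd (\<Sum>j = 1..m. p j)"
    and C0: "\<And>k. C (a * Suc k) (\<lambda>j\<in>{1..m}. 0)"
    and F: "fps_near_one F"
  shows "(\<lambda>n. of_nat (card {Y \<in> diagrams \<epsilon> m (a * e * n).
      \<forall>len\<in>row_lengths Y. a dvd len \<and> C len (\<lambda>j\<in>{1..m}. mult Y len j)}) * fps_X ^ n :: rat fps)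
    sums prodinf F"
  unfolding sums_def
proof (rule tendsto_fpsI)
  fix n
  let ?D = "\<lambda>n. {Y \<in> diagrams \<epsilon> m (a * e * n).
      \<forall>len\<in>row_lengths Y. a dvd len \<and> C len (\<lambda>j\<in>{1..m}. mult Y len j)}"
  define v where "v len p = len div a * ((\<Sum>j = 1..m. p j) div e)" for len and p :: "nat \<Rightarrow> nat"
  have ev: "\<forall>\<^sub>F L in sequentially. (\<Prod>k<L. F k) $ n = prodinf F $ n"
    using fps_near_one_has_prod(2)[OF F] by (simp add: tendsto_fps_iff)
  then obtain L0 where L0: "(\<Prod>k<L. F k) $ n = prodinf F $ n" if "L \<ge> L0" for L
    by (auto simp: eventually_sequentially)
  \<comment> \<open>From \<open>L0\<close> on, the partial products have the right coefficient
    \<open>n\<close>. The bound \<open>a * e * n\<close> on the number of boxes ensures that every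
    occurring row length lies in \<open>\<Lambda>\<close>.\<close>
  define L where "L = max L0 (a * e * n)"
  define \<Lambda> where "\<Lambda> = (\<lambda>k. a * Suc k) ` {..<L}"
  let ?S = "{Y \<in> young_diagrams \<epsilon> m. row_lengths Y \<subseteq> \<Lambda> \<and> (\<forall>len\<in>\<Lambda>. C len (\<lambda>j\<in>{1..m}. mult Y len j))}"
  let ?w = "\<lambda>Y. \<Sum>len\<in>\<Lambda>. v len (\<lambda>j\<in>{1..m}. mult Y len j)"
  have \<Lambda>: "finite \<Lambda>" "0 \<notin> \<Lambda>"
    using \<open>a > 0\<close> by (auto simp: \<Lambda>_def)
  have v: "v (a * Suc k) = (\<lambda>p. Suc k * ((\<Sum>j = 1..m. p j) div e))" for k
    using \<open>a > 0\<close> by (simp add: v_def fun_eq_iff del: mult_Suc_right)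
  have "gf ?S ?w = (\<Prod>len\<in>\<Lambda>. gf {p \<in> Pi\<^sub>E {1..m} (\<lambda>_. UNIV). C len p} (v len))"
    by (rule gf_diagrams[OF \<open>m > 0\<close> \<Lambda>]) (use ff P v in \<open>auto simp: \<Lambda>_def simp del: mult_Suc_right\<close>)
  also have "\<dots> = (\<Prod>k<L. gf {p \<in> Pi\<^sub>E {1..m} (\<lambda>_. UNIV). C (a * Suc k) p} (v (a * Suc k)))"
    unfolding \<Lambda>_def using \<open>a > 0\<close> by (subst prod.reindex) (auto simp: inj_on_def)
  also have "\<dots> = (\<Prod>k<L. F k)"
    by (simp only: v P[symmetric] gf)
  finally have "prodinf F $ n = gf ?S ?w $ n"
    using L0[of L] by (simp add: L_def)
  also have "\<dots> = of_nat (card {Y \<in> ?S. ?w Y = n})"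
    by (simp add: gf_def)
  also have "{Y \<in> ?S. ?w Y = n} = ?D n"
  proof (intro subset_antisym subsetI)
    have boxes: "boxes Y = a * e * ?w Y" if "Y \<in> ?S" for Y
    proof -
      have "boxes Y = (\<Sum>len\<in>\<Lambda>. len * (\<Sum>j = 1..m. mult Y len j))"
        using that boxes_eq_sum_mult \<Lambda>(1) by blast
      also have "\<dots> = (\<Sum>len\<in>\<Lambda>. a * e * v len (\<lambda>j\<in>{1..m}. mult Y len j))"
      proof (rule sum.cong)
        fix len assume len: "len \<in> \<Lambda>"
        then obtain k where k: "len = a * Suc k" by (auto simp: \<Lambda>_def)
        have "(\<lambda>j\<in>{1..m}. mult Y len j) \<in> P k"
          using that len unfolding P k[symmetric] by auto
        from dvd[OF this] have "e dvd (\<Sum>j = 1..m. mult Y len j)"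
          by simp
        then have "e * ((\<Sum>j = 1..m. mult Y len j) div e) = (\<Sum>j = 1..m. mult Y len j)"
          by simp
        moreover have "a * (len div a) = len"
          using k by simp
        moreover have "a * e * v len (\<lambda>j\<in>{1..m}. mult Y len j) =
            (a * (len div a)) * (e * ((\<Sum>j = 1..m. mult Y len j) div e))"
          by (simp add: v_def)
        ultimately show "len * (\<Sum>j = 1..m. mult Y len j) = a * e * v len (\<lambda>j\<in>{1..m}. mult Y len j)"
          by simp
      qed simp
      finally show ?thesis by (simp add: sum_distrib_left)
    qed
    fix Y
    show "Y \<in> ?D n" if Y: "Y \<in> {Y \<in> ?S. ?w Y = n}"
    proof -
      have "a dvd len" if "len \<in> row_lengths Y" for len
        using Y that by (auto simp: \<Lambda>_def)
      then show ?thesis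
        using Y boxes[of Y] unfolding diagrams_def by blast
    qed
    show "Y \<in> {Y \<in> ?S. ?w Y = n}" if Y: "Y \<in> ?D n"
    proof -
      have young: "Y \<in> young_diagrams \<epsilon> m" and bx: "boxes Y = a * e * n"
        using Y by (auto simp: diagrams_def)
      have "len \<in> \<Lambda>" if len: "len \<in> row_lengths Y" for len
      proof -
        obtain k where k: "len = a * k" using Y len by blast
        have "len > 0" using row_lengths_pos[OF young len] .
        then obtain k' where k': "k = Suc k'" using k by (cases k) auto
        have "k \<le> len" using k \<open>a > 0\<close> by simp
        also have "len \<le> boxes Y" using len length_le_boxes by (auto simp: row_lengths_def)
        finally have "k' < L" using bx k' by (simp add: L_def)
        then show ?thesis using k k' by (auto simp: \<Lambda>_def)
      qed
      then have sub: "row_lengths Y \<subseteq> \<Lambda>" by blast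
      \<comment> \<open>An absent length has the zero tuple, which satisfies \<open>C\<close> by
        \<open>C0\<close>; a condition on occurring lengths thus extends to all of
        \<open>\<Lambda>\<close>.\<close>
      have "C len (\<lambda>j\<in>{1..m}. mult Y len j)" if len: "len \<in> \<Lambda>" for len
      proof (cases "len \<in> row_lengths Y")
        case True
        then show ?thesis using Y by blast
      next
        case False
        obtain k where "len = a * Suc k" using len by (auto simp: \<Lambda>_def)
        then show ?thesis using C0[of k] mult_eq_0[OF False] by (simp add: restrict_def)
      qed
      with young sub have S: "Y \<in> ?S" by blast
      have "a * e * ?w Y = a * e * n"
        using boxes[OF S] bx by (simp only:)
      then have "?w Y = n"
        using assms(2,3) by simp
      with S show ?thesis by blast
    qed
  qed
  finally have *: "prodinf F $ n = of_nat (card (?D n))" .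
  show "\<forall>\<^sub>F L in sequentially. (\<Sum>i<L. of_nat (card (?D i)) * fps_X ^ i :: rat fps) $ n = prodinf F $ n"
    unfolding sum_fps_X_nth *
    using eventually_gt_at_top[of n] by eventually_elim simp
qed

section \<open>The reflection \<open>a \<mapsto> c - a\<close> of the residues modulo
  \<open>m\<close> and its fixed points\<close>

definition reflect :: "nat \<Rightarrow> nat \<Rightarrow> nat \<Rightarrow> nat" where
  "reflect m c a = residue m (c + (m - a))"

lemma reflect_eq_iff:
  assumes "m > 0" "a \<in> {1..m}" "b \<in> {1..m}"
  shows "reflect m c a = b \<longleftrightarrow> [a + b = c] (mod m)"
proof -
  have "reflect m c a = b \<longleftrightarrow> [b = c + (m - a)] (mod m)"
    unfolding reflect_def using eq_residue_iff[OF assms(1,3)] by metis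
  also have "\<dots> \<longleftrightarrow> [a + b = a + (c + (m - a))] (mod m)"
    by (simp only: cong_add_lcancel_nat)
  also have "a + (c + (m - a)) = c + m"
    using assms(2) by simp
  also have "[a + b = c + m] (mod m) \<longleftrightarrow> [a + b = c] (mod m)"
    by (simp add: cong_def)
  finally show ?thesis .
qed

lemma reflect_involution:
  assumes "m > 0" "a \<in> {1..m}"
  shows "reflect m c a \<in> {1..m} \<and> reflect m c (reflect m c a) = a"
proof
  show r: "reflect m c a \<in> {1..m}"
    unfolding reflect_def by (rule residue(1)[OF assms(1)])
  have "[a + reflect m c a = c] (mod m)"
    using reflect_eq_iff[OF assms r, of c] by simp
  then show "reflect m c (reflect m c a) = a"
    using reflect_eq_iff[OF assms(1) r assms(2)] by (simp add: add.commute)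
qed

definition fixed_points :: "nat \<Rightarrow> nat \<Rightarrow> nat set" where
  "fixed_points m c = {a \<in> {1..m}. [2 * a = c] (mod m)}"

text \<open>Modulo \<open>2 * l + 1\<close> the inverse of 2 is \<open>l + 1\<close>, so
  \<open>2 a = c\<close> has one solution.\<close>

lemma card_fixed_points_odd: "card (fixed_points (2 * l + 1) c) = 1"
proof -
  let ?m = "2 * l + 1"
  have "[2 * a = c] (mod ?m) \<longleftrightarrow> [a = (l + 1) * c] (mod ?m)" for a
  proof -
    have "coprime (l + 1) ?m"
    proof (rule coprimeI)
      fix x assume "x dvd l + 1" "x dvd ?m"
      then have "x dvd 2 * (l + 1) - ?m" by (meson dvd_diff_nat dvd_mult)
      then show "is_unit x" by simp
    qed
    then have "[2 * a = c] (mod ?m) \<longleftrightarrow> [(l + 1) * (2 * a) = (l + 1) * c] (mod ?m)"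
      by (simp only: cong_mult_lcancel_nat)
    also have "(l + 1) * (2 * a) = a + a * ?m"
      by (simp add: algebra_simps)
    also have "[a + a * ?m = (l + 1) * c] (mod ?m) \<longleftrightarrow> [a = (l + 1) * c] (mod ?m)"
      unfolding cong_def by (simp only: mod_mult_self1)
    finally show ?thesis .
  qed
  then have "fixed_points ?m c = {residue ?m ((l + 1) * c)}"
    using eq_residue_iff[of ?m _ "(l + 1) * c"] residue(1)[of ?m "(l + 1) * c"]
    by (auto simp: fixed_points_def)
  then show ?thesis by simp
qed

text \<open>For \<open>c = 2 * c'\<close> the equation reduces to \<open>a = c'\<close> modulo
  \<open>l\<close>, which has two solutions in \<open>{1..2 * l}\<close>, differing by
  \<open>l\<close>. An odd \<open>c\<close> is excluded by parity.\<close>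

lemma card_fixed_points_even:
  assumes "l > 0"
  shows "card (fixed_points (2 * l) c) = (if even c then 2 else 0)"
proof (cases "even c")
  case True
  then obtain c' where c: "c = 2 * c'" by blast
  let ?r = "residue l c'"
  have r: "?r \<in> {1..l}" by (rule residue(1)[OF assms])
  have cong: "[2 * a = c] (mod 2 * l) \<longleftrightarrow> [a = c'] (mod l)" for a
    by (simp add: c cong_def mult_mod_right[symmetric])
  have "fixed_points (2 * l) c = {?r, ?r + l}"
  proof (intro subset_antisym subsetI)
    fix a assume a: "a \<in> fixed_points (2 * l) c"
    then have ac: "[a = c'] (mod l)" "a \<in> {1..2 * l}" by (auto simp: fixed_points_def cong)
    show "a \<in> {?r, ?r + l}"
    proof (cases "a \<le> l")
      case True
      then show ?thesis using eq_residue_iff[OF assms, of a c'] ac by auto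
    next
      case False
      then have "[a - l + l = c'] (mod l)" using ac(1) by simp
      then have "[a - l = c'] (mod l)" by (simp add: cong_def)
          moreover have "a - l \<in> {1..l}" using ac(2) False by auto
          ultimately have "a - l = ?r" using eq_residue_iff[OF assms, of "a - l" c'] by blast
      then show ?thesis using False by auto
    qed
  next
    fix a assume "a \<in> {?r, ?r + l}"
    moreover have "[?r = c'] (mod l)" by (rule residue(2)[OF assms])
    then have "[?r + l = c'] (mod l)" by (simp add: cong_def)
    ultimately show "a \<in> fixed_points (2 * l) c"
      using r \<open>[?r = c'] (mod l)\<close> by (auto simp: fixed_points_def cong)
  qed
  then show ?thesis using True assms by simp
next
  case False
  have "\<not> [2 * a = c] (mod 2 * l)" for a
  proof
    assume "[2 * a = c] (mod 2 * l)"
    then have "[2 * a = c] (mod 2)" by (rule cong_dvd_modulus_nat) simp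
    then show False using False by (auto simp: cong_def)
  qed
  then have "fixed_points (2 * l) c = {}" by (auto simp: fixed_points_def)
  with False show ?thesis by simp
qed

text \<open>All requirements of (ii) on a single row length: \<open>c\<close> is the length in types
  A and D, and one less in type C.\<close>

definition reflective :: "nat \<Rightarrow> nat \<Rightarrow> (nat \<Rightarrow> nat) \<Rightarrow> bool" where
  "reflective m c p \<longleftrightarrow>
     (\<forall>a\<in>{1..m}. \<forall>b\<in>{1..m}. [a + b = c] (mod m) \<longrightarrow> p a = p b) \<and>
     (\<forall>a\<in>{1..m}. [2 * a = c] (mod m) \<longrightarrow> even (p a)) \<and> Min (p ` {1..m}) \<le> 1"

lemma reflective_cong: "(\<And>a. a \<in> {1..m} \<Longrightarrow> p a = q a) \<Longrightarrow> reflective m c p \<longleftrightarrow> reflective m c q"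
proof -
  assume eq: "\<And>a. a \<in> {1..m} \<Longrightarrow> p a = q a"
  then have "p ` {1..m} = q ` {1..m}"
    by (rule image_cong[OF refl])
  then show ?thesis
    unfolding reflective_def by (intro arg_cong2[where f = "(\<and>)"] ball_cong refl) (simp_all add: eq)
qed

lemma symmetric_tuples_reflect:
  assumes "m > 0"
  shows "symmetric_tuples {1..m} (reflect m c) = {p \<in> Pi\<^sub>E {1..m} (\<lambda>_. UNIV). reflective m c p}"
  unfolding symmetric_tuples_def
proof (rule Collect_cong)
  fix p :: "nat \<Rightarrow> nat"
  have "(\<forall>a\<in>{1..m}. p (reflect m c a) = p a) \<longleftrightarrow>
      (\<forall>a\<in>{1..m}. \<forall>b\<in>{1..m}. [a + b = c] (mod m) \<longrightarrow> p a = p b)"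
    using reflect_eq_iff[OF assms] reflect_involution[OF assms] by metis
  moreover have "(\<forall>a\<in>{1..m}. reflect m c a = a \<longrightarrow> even (p a)) \<longleftrightarrow>
      (\<forall>a\<in>{1..m}. [2 * a = c] (mod m) \<longrightarrow> even (p a))"
    using reflect_eq_iff[OF assms] by (simp add: mult_2)
  moreover have "(\<exists>a\<in>{1..m}. p a \<le> 1) \<longleftrightarrow> Min (p ` {1..m}) \<le> 1"
    using assms by (subst Min_le_iff) auto
  ultimately show "p \<in> Pi\<^sub>E {1..m} (\<lambda>_. UNIV) \<and> (\<forall>a\<in>{1..m}. p (reflect m c a) = p a) \<and>
      (\<forall>a\<in>{1..m}. reflect m c a = a \<longrightarrow> even (p a)) \<and> (\<exists>a\<in>{1..m}. p a \<le> 1) \<longleftrightarrow>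
      p \<in> Pi\<^sub>E {1..m} (\<lambda>_. UNIV) \<and> reflective m c p"
    unfolding reflective_def by (simp only:)
qed

text \<open>\<open>d k\<close> is the number of orbits of the reflection belonging to rows of length
  \<open>Suc k\<close>; it may depend on the length through its fixed points.\<close>

lemma sums_reflective:
  assumes m: "m > 0" and d: "\<And>k. m + card (fixed_points m (c (Suc k))) = 2 * d k"
  shows "(\<lambda>n. of_nat (card {Y \<in> diagrams \<epsilon> m (2 * n). \<forall>len\<in>row_lengths Y. reflective m (c len) (mult Y len)})
      * fps_X ^ n :: rat fps) sums (\<Prod>k. (1 - fps_X ^ (m * Suc k)) / (1 - fps_X ^ Suc k) ^ d k)"
proof -
  let ?F = "\<lambda>k. (1 - fps_X ^ (m * Suc k)) / (1 - fps_X ^ Suc k) ^ d k :: rat fps"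
  let ?P = "\<lambda>k. symmetric_tuples {1..m} (reflect m (c (Suc k)))"
  have fp: "{a \<in> {1..m}. reflect m c a = a} = fixed_points m c" for c
    using reflect_eq_iff[OF m] by (auto simp: fixed_points_def mult_2)
  have d': "card {1..m} + card {a \<in> {1..m}. reflect m (c (Suc k)) a = a} = 2 * d k" for k
    unfolding fp using d by simp
  note gf = gf_symmetric_tuples[OF finite_atLeastAtMost reflect_involution[OF m] zero_less_Suc d']
  have near: "fps_near_one ?F"
  proof -
    \<comment> \<open>The exponent varies with \<open>k\<close>, so the rule for a constant exponent
      is applied with \<open>d k\<close> and read off at the index \<open>k\<close> alone.\<close>
    have "fps_near_one (\<lambda>k. (1 - fps_X ^ Suc k) ^ d k)"
      unfolding fps_near_one_def
    proof (intro allI impI)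
      fix k n :: nat assume "n \<le> k"
      then show "(1 - fps_X ^ Suc k) ^ d k $ n = (1 :: rat fps) $ n"
        using fps_near_one_power[OF fps_near_one_minus_X_Suc, of "d k"]
        by (simp add: fps_near_one_def)
    qed
    then show ?thesis
      by (intro near_one m)
  qed
  have "(\<lambda>n. of_nat (card {Y \<in> diagrams \<epsilon> m (1 * 2 * n).
      \<forall>len\<in>row_lengths Y. 1 dvd len \<and> reflective m (c len) (\<lambda>j\<in>{1..m}. mult Y len j)}) * fps_X ^ n :: rat fps)
    sums prodinf ?F"
  proof (rule sums_diagrams[where P = ?P])
    show "?P k = {p \<in> Pi\<^sub>E {1..m} (\<lambda>_. UNIV). reflective m (c (1 * Suc k)) p}" for k
      using symmetric_tuples_reflect[OF m] by simp
    show "gf (?P k) (\<lambda>p. Suc k * ((\<Sum>j = 1..m. p j) div 2)) = ?F k" for k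
      using gf(1)[of "k" k] by (simp add: mult.commute del: mult_Suc mult_Suc_right)
    show "finite_fibres (?P k) (\<lambda>p. Suc k * ((\<Sum>j = 1..m. p j) div 2))" for k
      by (rule gf(2))
    show "2 dvd (\<Sum>j = 1..m. p j)" if "p \<in> ?P k" for k p
      by (rule gf(3)) (use that in auto)
    show "reflective m (c (1 * Suc k)) (\<lambda>j\<in>{1..m}. 0)" for k
    proof -
      have "(\<lambda>j\<in>{1..m}. 0 :: nat) ` {1..m} = {0}" using m by (auto simp: image_def)
      then show ?thesis by (simp add: reflective_def)
    qed
  qed (use m near in simp_all)
  moreover have "reflective m c (\<lambda>j\<in>{1..m}. mult Y len j) \<longleftrightarrow> reflective m c (mult Y len)" for c Y len
    by (rule reflective_cong) simp
  ultimately show ?thesis by simp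
qed

subsection \<open>The generating functions\<close>

text \<open>Divisibility of the gcd is divisibility of every length, and all indices
  \<open>i + k * d\<close> lie in \<open>{1..m}\<close>, so restricting the multiplicities to that
  range changes nothing.\<close>

lemma Sigma0_eq:
  assumes "m > 0" "d = gcd a m"
  shows "Sigma0 \<epsilon> a m N = {Y \<in> diagrams \<epsilon> m N. \<forall>len\<in>row_lengths Y. a dvd len \<and>
    (\<forall>i\<in>{1..d}. (\<Prod>k = 0..m div d - 1. (\<lambda>j\<in>{1..m}. mult Y len j) (i + k * d)) = 0)}"
proof -
  have d: "d > 0" "d dvd m" "m div d > 0"
    using assms by (auto simp: div_greater_zero_iff gcd_le2_nat)
  have "i + k * d \<in> {1..m}" if "i \<in> {1..d}" "k \<in> {0..m div d - 1}" for i k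
    using bij_betw_apply[OF bij_betw_add_mult[OF d(1,2)], of "(i, k)"] that d(3) by auto
  then have "(\<Prod>k = 0..m div d - 1. (\<lambda>j\<in>{1..m}. f j) (i + k * d)) =
      (\<Prod>k = 0..m div d - 1. f (i + k * d))" if "i \<in> {1..d}" for i and f :: "nat \<Rightarrow> nat"
    using that by (intro prod.cong) (simp_all only: restrict_apply' if_True)
  then show ?thesis
    unfolding Sigma0_def Let_def assms(2)[symmetric] dvd_Gcd_iff by auto
qed

text \<open>Ensures that a term in which \<open>N div a\<close> would be rounded has coefficient
  0.\<close>

lemma Sigma0_eq_empty: "\<not> a dvd N \<Longrightarrow> Sigma0 \<epsilon> a m N = {}"
  using dvd_boxes by (fastforce simp: Sigma0_def diagrams_def dvd_Gcd_iff)

lemma sums_Sigma0: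
  assumes "m > 0" "a > 0" "d = gcd a m"
  shows "(\<lambda>N. of_nat (card (Sigma0 \<epsilon> a m N)) * fps_X ^ (N div a) :: rat fps) sums
          ((\<Prod>k. (1 - fps_X ^ ((m div d) * Suc k)) ^ d) / (\<Prod>k. (1 - fps_X ^ Suc k) ^ m))"
proof -
  have d: "d > 0" "d dvd m" "m div d > 0"
    using assms by (auto simp: div_greater_zero_iff gcd_le2_nat)
  let ?f = "\<lambda>N. of_nat (card (Sigma0 \<epsilon> a m N)) * fps_X ^ (N div a) :: rat fps"
  let ?F = "\<lambda>k. (1 - fps_X ^ ((m div d) * Suc k)) ^ d / (1 - fps_X ^ Suc k) ^ m :: rat fps"
  let ?C = "\<lambda>len p. \<forall>i\<in>{1..d}. (\<Prod>k = 0..m div d - 1. p (i + k * d)) = (0 :: nat)"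
  have "(\<lambda>n. of_nat (card {Y \<in> diagrams \<epsilon> m (a * 1 * n).
      \<forall>len\<in>row_lengths Y. a dvd len \<and> ?C len (\<lambda>j\<in>{1..m}. mult Y len j)}) * fps_X ^ n :: rat fps)
    sums prodinf ?F"
  proof (rule sums_diagrams[where P = "\<lambda>_. aperiodic_tuples d m"])
    show "gf (aperiodic_tuples d m) (\<lambda>p. Suc k * ((\<Sum>j = 1..m. p j) div 1)) = ?F k" for k
      using gf_aperiodic_tuples(1)[OF d(1,2) assms(1), of "Suc k"]
      by (simp add: mult.commute del: mult_Suc mult_Suc_right)
    show "finite_fibres (aperiodic_tuples d m) (\<lambda>p. Suc k * ((\<Sum>j = 1..m. p j) div 1))" for k
      using gf_aperiodic_tuples(2)[OF d(1,2) assms(1), of "Suc k"] by simp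
    show "\<forall>i\<in>{1..d}. (\<Prod>k = 0..m div d - 1. (\<lambda>j\<in>{1..m}. 0) (i + k * d)) = (0 :: nat)"
    proof
      fix i assume "i \<in> {1..d}"
      \<comment> \<open>The index \<open>i\<close> itself, at \<open>k = 0\<close>, supplies the
        zero factor; outside \<open>{1..m}\<close> the restricted tuple would be
        \<open>undefined\<close>.\<close>
      then have "i \<in> {1..m}"
        using d(2) assms(1) by (meson atLeastAtMost_iff dvd_imp_le le_trans)
      then show "(\<Prod>k = 0..m div d - 1. (\<lambda>j\<in>{1..m}. 0) (i + k * d)) = (0 :: nat)"
        by (intro prod_zero) (auto intro!: bexI[of _ 0])
    qed
    show "fps_near_one ?F"
      by (intro near_one d)
  qed (use assms in \<open>simp_all add: aperiodic_tuples_def\<close>)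
  then have "(\<lambda>n. ?f (a * n)) sums prodinf ?F"
    unfolding Sigma0_eq[OF assms(1,3), symmetric] using assms(2) by simp
  \<comment> \<open>Only multiples of \<open>a\<close> contribute, so the series over
    \<open>N\<close> and the one over \<open>N = a * n\<close> have the same sum.\<close>
  also have "(\<lambda>n. ?f (a * n)) sums prodinf ?F \<longleftrightarrow> ?f sums prodinf ?F"
  proof (rule sums_mono_reindex)
    show "strict_mono (\<lambda>n. a * n)"
      using assms(2) by (simp add: strict_mono_def)
    show "?f N = 0" if "N \<notin> range (\<lambda>n. a * n)" for N
    proof -
      have "\<not> a dvd N"
        using that by blast
      then show ?thesis
        by (simp add: Sigma0_eq_empty)
    qed
  qed
  also have "prodinf ?F = (\<Prod>k. (1 - fps_X ^ ((m div d) * Suc k)) ^ d) / (\<Prod>k. (1 - fps_X ^ Suc k) ^ m)"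
    by (rule prodinf_fps_divide[symmetric]; intro near_one d)
  finally show ?thesis .
qed

lemma Sigma0_ACD_eq:
  shows "Sigma0_A \<epsilon> m N = {Y \<in> diagrams \<epsilon> m N. \<forall>len\<in>row_lengths Y. reflective m len (mult Y len)}"
    and "Sigma0_C \<epsilon> m N = {Y \<in> diagrams \<epsilon> m N. \<forall>len\<in>row_lengths Y. reflective m (len - 1) (mult Y len)}"
    and "Sigma0_D \<epsilon> m N = {Y \<in> diagrams \<epsilon> m N. \<forall>len\<in>row_lengths Y. reflective m len (mult Y len)}"
  unfolding Sigma0_A_def Sigma_A_def Sigma0_C_def Sigma_C_def Sigma0_D_def Sigma_D_def
    min_le_one_def reflective_def by blast+

lemma one_minus_X_nz: "(1 - fps_X ^ Suc k) ^ n $ 0 \<noteq> (0 :: rat)"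
  by (simp add: fps_power_zeroth)

text \<open>The single fixed point gives \<open>(2 * l + 1 + 1) / 2 = l + 1\<close> orbits for every
  length.\<close>

lemma sums_Sigma0_A:
  "(\<lambda>n. of_nat (card (Sigma0_A \<epsilon> (2 * l + 1) (2 * n))) * fps_X ^ n :: rat fps) sums
     (\<Prod>k. (1 - fps_X ^ ((2 * l + 1) * Suc k)) / (1 - fps_X ^ Suc k) ^ (l + 1))"
  unfolding Sigma0_ACD_eq
  by (rule sums_reflective) (simp_all only: card_fixed_points_odd, simp_all)

text \<open>Separates the one factor that depends on the parity of the row length.\<close>

lemma geometric_power_if:
  "N / (1 - fps_X ^ Suc k) ^ (if Q then l + 1 else l) =
     N / (1 - fps_X ^ Suc k) ^ l * (if Q then 1 / (1 - fps_X ^ Suc k) else 1 :: rat fps)"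
  using one_minus_X_nz[of k l] one_minus_X_nz[of k "Suc l"]
  by (auto simp: fps_divide_unit fps_inverse_mult mult_ac simp del: power_Suc)
    (simp add: fps_inverse_mult mult_ac)

text \<open>Here \<open>c\<close> is the length minus 1, so the two fixed points occur at odd
  lengths, giving \<open>l + 1\<close> orbits there and \<open>l\<close> at even lengths. Euler's
  theorem turns the extra odd factors into the product of all \<open>1 + x^k\<close>.\<close>

lemma sums_Sigma0_C:
  assumes "l > 0"
  shows "(\<lambda>n. of_nat (card (Sigma0_C \<epsilon> (2 * l) (2 * n))) * fps_X ^ n :: rat fps) sums
     (\<Prod>k. (1 - fps_X ^ (2 * l * Suc k)) * (1 + fps_X ^ Suc k) / (1 - fps_X ^ Suc k) ^ l)"
proof -
  let ?N = "\<lambda>k. 1 - fps_X ^ (2 * l * Suc k) :: rat fps" and ?u = "\<lambda>k. 1 - fps_X ^ Suc k :: rat fps"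
  have near: "fps_near_one (\<lambda>k. ?N k / ?u k ^ l)"
    using assms by (intro near_one) simp
  have "(\<lambda>n. of_nat (card (Sigma0_C \<epsilon> (2 * l) (2 * n))) * fps_X ^ n :: rat fps) sums
      (\<Prod>k. ?N k / ?u k ^ (if odd (Suc k) then l + 1 else l))"
    unfolding Sigma0_ACD_eq by (rule sums_reflective) (use assms in \<open>simp_all add: card_fixed_points_even\<close>)
  also have "(\<Prod>k. ?N k / ?u k ^ (if odd (Suc k) then l + 1 else l)) =
      (\<Prod>k. ?N k / ?u k ^ l) * (\<Prod>k. if odd (Suc k) then 1 / ?u k else 1)"
    unfolding geometric_power_if by (rule prodinf_fps_mult[symmetric]; intro near near_one)
  also have "\<dots> = (\<Prod>k. ?N k / ?u k ^ l * (1 + fps_X ^ Suc k))"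
    unfolding prodinf_geometric_odd by (rule prodinf_fps_mult; intro near near_one)
  also have "(\<lambda>k. ?N k / ?u k ^ l * (1 + fps_X ^ Suc k)) = (\<lambda>k. ?N k * (1 + fps_X ^ Suc k) / ?u k ^ l)"
    by (simp only: fps_divide_unit[OF one_minus_X_nz] mult_ac)
  finally show ?thesis .
qed

text \<open>Now \<open>c\<close> is the length itself, so the extra factor occurs at even lengths,
  where \<open>1 - x^(2 k)\<close> splits as a difference of squares.\<close>

lemma sums_Sigma0_D:
  assumes "l > 0"
  shows "(\<lambda>n. of_nat (card (Sigma0_D \<epsilon> (2 * l) (2 * n))) * fps_X ^ n :: rat fps) sums
     (\<Prod>k. (1 - fps_X ^ (2 * l * Suc k)) / ((1 - fps_X ^ Suc k) ^ (l + 1) * (1 + fps_X ^ Suc k)))"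
proof -
  let ?N = "\<lambda>k. 1 - fps_X ^ (2 * l * Suc k) :: rat fps" and ?u = "\<lambda>k. 1 - fps_X ^ Suc k :: rat fps"
  have near: "fps_near_one (\<lambda>k. ?N k / ?u k ^ l)"
    using assms by (intro near_one) simp
  have "(\<lambda>n. of_nat (card (Sigma0_D \<epsilon> (2 * l) (2 * n))) * fps_X ^ n :: rat fps) sums
      (\<Prod>k. ?N k / ?u k ^ (if even (Suc k) then l + 1 else l))"
    unfolding Sigma0_ACD_eq by (rule sums_reflective) (use assms in \<open>simp_all add: card_fixed_points_even\<close>)
  also have "(\<Prod>k. ?N k / ?u k ^ (if even (Suc k) then l + 1 else l)) =
      (\<Prod>k. ?N k / ?u k ^ l) * (\<Prod>k. if even (Suc k) then 1 / ?u k else 1)"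
    unfolding geometric_power_if by (rule prodinf_fps_mult[symmetric]; intro near near_one)
  also have "\<dots> = (\<Prod>k. ?N k / ?u k ^ l * (1 / (?u k * (1 + fps_X ^ Suc k))))"
    unfolding prodinf_geometric_even by (rule prodinf_fps_mult; intro near near_one)
  also have "(\<lambda>k. ?N k / ?u k ^ l * (1 / (?u k * (1 + fps_X ^ Suc k)))) =
      (\<lambda>k. ?N k / (?u k ^ (l + 1) * (1 + fps_X ^ Suc k)))"
  proof
    fix k
    have nz: "(?u k * (1 + fps_X ^ Suc k)) $ 0 \<noteq> 0" "(?u k ^ (l + 1) * (1 + fps_X ^ Suc k)) $ 0 \<noteq> 0"
      by (simp_all add: fps_power_zeroth)
    show "?N k / ?u k ^ l * (1 / (?u k * (1 + fps_X ^ Suc k))) =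
        ?N k / (?u k ^ (l + 1) * (1 + fps_X ^ Suc k))"
      unfolding fps_divide_unit[OF one_minus_X_nz] fps_divide_unit[OF nz(1)] fps_divide_unit[OF nz(2)]
      by (simp only: fps_inverse_mult power_add power_one_right mult_ac mult_1_left)
  qed
  finally show ?thesis .
qed

theorem lemma3p3:
  fixes \<epsilon> :: sign
  shows
    "(\<forall>m a d :: nat. m > 0 \<longrightarrow> a > 0 \<longrightarrow> d = gcd a m \<longrightarrow>
        (\<lambda>N. of_nat (card (Sigma0 \<epsilon> a m N)) * fps_X ^ (N div a) :: rat fps) sums
          ((\<Prod>k. (1 - fps_X ^ ((m div d) * Suc k)) ^ d) / (\<Prod>k. (1 - fps_X ^ Suc k) ^ m)))
     \<and>
     (\<forall>l m\<^sub>0 :: nat. m\<^sub>0 = 2 * l + 1 \<longrightarrow>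
        (\<lambda>n. of_nat (card (Sigma0_A \<epsilon> m\<^sub>0 (2 * n))) * fps_X ^ n :: rat fps) sums
          (\<Prod>k. (1 - fps_X ^ ((2 * l + 1) * Suc k)) / (1 - fps_X ^ Suc k) ^ (l + 1)))
     \<and>
     (\<forall>l m :: nat. l \<ge> 1 \<longrightarrow> m = 2 * l \<longrightarrow>
        (\<lambda>n. of_nat (card (Sigma0_C \<epsilon> m (2 * n))) * fps_X ^ n :: rat fps) sums
          (\<Prod>k. (1 - fps_X ^ (2 * l * Suc k)) * (1 + fps_X ^ Suc k) / (1 - fps_X ^ Suc k) ^ l)
        \<and>
        (\<lambda>n. of_nat (card (Sigma0_D \<epsilon> m (2 * n))) * fps_X ^ n :: rat fps) sums
          (\<Prod>k. (1 - fps_X ^ (2 * l * Suc k)) /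
                 ((1 - fps_X ^ Suc k) ^ (l + 1) * (1 + fps_X ^ Suc k))))"
  using sums_Sigma0 sums_Sigma0_A sums_Sigma0_C sums_Sigma0_D by (auto simp only: One_nat_def Suc_le_eq)

end
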